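(* Consider the linear Gaussian state-space model $x_k=A_kx_{k-1}+q_k$ ($k=1,\dots,T$), $y_k=C_kx_k+r_k$ ($k=0,\dots,T$), with independent white Gaussian noises $q_k\sim\mathcal{N}(0,Q_k)$, $r_k\sim\mathcal{N}(0,R_k)$ and $x_0\sim\mathcal{N}(0,P_0)$ independent of them. Let $Y_0^T=(y_0,\dots,y_T)$ and let $(J_0^T,Y_0^T)$, $J_0^T=(J_0,\dots,J_T)$, be jointly distributed with finite second moments such that, for every $k\in\{0,\dots,T\}$ and every $n\ge1$ with $k+n\le T$, $J_k$ is conditionally independent of $y_{k+n}$ given $Y_0^k=(y_0,\dots,y_k)$. Then $\mathbb{E}[J_k\mathcal{I}_{k+n}^\top]=0$ for all such $k,n$.
   Context: The innovation process is $\mathcal{I}_k=y_k-C_k\hat x^*_{k|k-1}$ with $\hat x^*_{k|k-1}=\mathbb{E}[x_k\mid y_0,\dots,y_{k-1}]$, and $\mathcal{I}_0=y_0$. *)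

theory Defs
  imports "HOL-Probability.Probability"
begin

definition real_gaussian0 :: "'a measure \<Rightarrow> ('a \<Rightarrow> real) \<Rightarrow> real \<Rightarrow> bool" where
  "real_gaussian0 M X v \<longleftrightarrow>
     X \<in> borel_measurable M \<and>
     ((v = 0 \<and> (AE \<omega> in M. X \<omega> = 0)) \<or>
      (0 < v \<and> distributed M lborel X (normal_density 0 (sqrt v))))"

definition gaussian_vec0 :: "'a measure \<Rightarrow> ('a \<Rightarrow> real ^ 'n) \<Rightarrow> real ^ 'n ^ 'n \<Rightarrow> bool" where
  "gaussian_vec0 M X S \<longleftrightarrow>
     X \<in> borel_measurable M \<and>
     (\<forall>u :: real ^ 'n. real_gaussian0 M (\<lambda>\<omega>. u \<bullet> X \<omega>) (u \<bullet> (S *v u)))"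

definition gen_sigma :: "'a measure \<Rightarrow> ('i \<Rightarrow> 'a \<Rightarrow> 'b::topological_space) \<Rightarrow> 'i set \<Rightarrow> 'a measure" where
  "gen_sigma M Y J = sigma (space M) (\<Union>j\<in>J. {Y j -` A \<inter> space M | A. A \<in> sets borel})"

definition vcond_exp :: "'a measure \<Rightarrow> 'a measure \<Rightarrow> ('a \<Rightarrow> real ^ 'n) \<Rightarrow> ('a \<Rightarrow> real ^ 'n)" where
  "vcond_exp M F X = (\<lambda>\<omega>. \<chi> i. real_cond_exp M F (\<lambda>\<eta>. X \<eta> $ i) \<omega>)"

definition innovation ::
  "'a measure \<Rightarrow> (nat \<Rightarrow> real ^ 'n ^ 'm) \<Rightarrow> (nat \<Rightarrow> 'a \<Rightarrow> real ^ 'n) \<Rightarrow> (nat \<Rightarrow> 'a \<Rightarrow> real ^ 'm)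
     \<Rightarrow> nat \<Rightarrow> 'a \<Rightarrow> real ^ 'm" where
  "innovation M C x y k =
     (if k = 0 then y 0
      else (\<lambda>\<omega>. y k \<omega> - C k *v vcond_exp M (gen_sigma M y {..<k}) (x k) \<omega>))"

definition cond_indep :: "'a measure \<Rightarrow> 'a measure \<Rightarrow> ('a \<Rightarrow> 'b::topological_space) \<Rightarrow> ('a \<Rightarrow> 'c::topological_space) \<Rightarrow> bool" where
  "cond_indep M G X Z \<longleftrightarrow>
     (\<forall>A \<in> sets borel. \<forall>B \<in> sets borel.
        AE \<omega> in M. real_cond_exp M G (indicator (X -` A \<inter> Z -` B \<inter> space M)) \<omega> =
                   real_cond_exp M G (indicator (X -` A \<inter> space M)) \<omega> *
                   real_cond_exp M G (indicator (Z -` B \<inter> space M)) \<omega>)"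

(* index type for the primitive random sources x_0, q_k, r_k *)
datatype src_idx = X0 | Qn nat | Rn nat

end

theory Submission
  imports Defs
begin

text \<open>
  The random variables that are linear in \<open>x\<^sub>0\<close>, \<open>q\<^sub>k\<close>, \<open>r\<^sub>k\<close> form a Gaussian space, in which
  uncorrelated variables are independent. Hence the conditional expectation of \<open>x\<^sub>m\<close> given
  \<open>y\<^sub>0, \<dots>, y\<^sub>m\<^sub>-\<^sub>1\<close> is an orthogonal projection, and the innovation at time \<open>m = k + n\<close> is almost
  surely a linear combination of \<open>y\<^sub>0, \<dots>, y\<^sub>m\<close> whose conditional expectation given
  \<open>y\<^sub>0, \<dots>, y\<^sub>m\<^sub>-\<^sub>1\<close> vanishes. Because the innovation is linear in the observations, conditional
  independence of \<open>J\<^sub>k\<close> from each single \<open>y\<^sub>l\<close> with \<open>k < l\<close> suffices to replace \<open>J\<^sub>k\<close> by its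
  conditional expectation given \<open>y\<^sub>0, \<dots>, y\<^sub>k\<close>, which is orthogonal to the innovation.
  That a conditional expectation vanishes is detected by Fourier transforms; the case of several
  variables is reduced to the one-dimensional uniqueness theorem of Levy by conditioning on one
  coordinate at a time.
\<close>

text \<open>Vanishing integrals over all sets of \<open>F\<close> mean that the conditional
  expectation of \<open>V\<close> given \<open>F\<close> is 0 almost surely, and an
  \<open>F\<close>-measurable factor can be moved through it. The factor may be unbounded as long as
  the product is integrable.\<close>

lemma (in finite_measure) integral_mult_eq_0_subalgebra:
  fixes V f :: "'a \<Rightarrow> real"
  assumes F: "subalgebra M F" and V: "integrable M V"
    and zero: "\<And>A. A \<in> sets F \<Longrightarrow> (\<integral>\<omega>. indicator A \<omega> * V \<omega> \<partial>M) = 0"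
    and f: "f \<in> borel_measurable F" and fV: "integrable M (\<lambda>\<omega>. f \<omega> * V \<omega>)"
  shows "(\<integral>\<omega>. f \<omega> * V \<omega> \<partial>M) = 0"
proof -
  interpret finite_measure_subalgebra M F by unfold_locales (rule F)
  have [measurable]: "f \<in> borel_measurable M" "V \<in> borel_measurable M"
    using measurable_from_subalg[OF F f] V by auto
  have "AE \<omega> in M. real_cond_exp M F V \<omega> = 0"
    by (rule real_cond_exp_charact) (use V zero in \<open>auto simp: set_lebesgue_integral_def\<close>)
  then have "(\<integral>\<omega>. f \<omega> * real_cond_exp M F V \<omega> \<partial>M) = (\<integral>\<omega>. 0 \<partial>M)"
    by (intro integral_cong_AE) auto
  then show ?thesis
    using real_cond_exp_intg(2)[OF fV f] by simp
qed

text \<open>The case of the sigma-algebra generated by \<open>X\<close>: its sets are exactly the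
  preimages of Borel sets, and \<open>g\<close> composed with \<open>X\<close> is measurable for
  it.\<close>

lemma (in finite_measure) integral_mult_eq_0_vimage:
  fixes V :: "'a \<Rightarrow> real" and X :: "'a \<Rightarrow> 'b::topological_space" and g :: "'b \<Rightarrow> real"
  assumes X: "X \<in> borel_measurable M" and V: "integrable M V"
    and zero: "\<And>B. B \<in> sets borel \<Longrightarrow> (\<integral>\<omega>. indicator (X -` B \<inter> space M) \<omega> * V \<omega> \<partial>M) = 0"
    and g: "g \<in> borel_measurable borel" and gV: "integrable M (\<lambda>\<omega>. g (X \<omega>) * V \<omega>)"
  shows "(\<integral>\<omega>. g (X \<omega>) * V \<omega> \<partial>M) = 0"
proof (rule integral_mult_eq_0_subalgebra[of "vimage_algebra (space M) X borel"])
  have s: "sets (vimage_algebra (space M) X borel) = {X -` B \<inter> space M |B. B \<in> sets borel}"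
    by (rule sets_vimage_algebra2) auto
  show "subalgebra M (vimage_algebra (space M) X borel)"
    using measurable_sets[OF X] by (auto simp: subalgebra_def s)
  show "(\<lambda>\<omega>. g (X \<omega>)) \<in> borel_measurable (vimage_algebra (space M) X borel)"
    by (rule measurable_compose[OF measurable_vimage_algebra1 g]) auto
  show "(\<integral>\<omega>. indicator A \<omega> * V \<omega> \<partial>M) = 0" if "A \<in> sets (vimage_algebra (space M) X borel)" for A
    using that zero by (auto simp: s)
qed (rule V, rule gV)

section \<open>Random variables with vanishing Fourier transform\<close>

text \<open>A nonnegative weight of mean 1 turns the law of \<open>Y\<close> into another
  probability law on the line. Weighted Fourier integrals thereby become characteristic functions,
  to which Levy's uniqueness theorem applies.\<close>

lemma (in prob_space) distr_density_prob:
  fixes h Y :: "'a \<Rightarrow> real"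
  assumes [measurable]: "Y \<in> borel_measurable M"
    and h: "integrable M h" "\<And>\<omega>. 0 \<le> h \<omega>" "expectation h = 1"
  shows "real_distribution (distr (density M h) borel Y)"
    and "char (distr (density M h) borel Y) t = (CLINT \<omega>|M. h \<omega> *\<^sub>R iexp (t * Y \<omega>))"
    and "B \<in> sets borel \<Longrightarrow>
      measure (distr (density M h) borel Y) B = (\<integral>\<omega>. indicator B (Y \<omega>) * h \<omega> \<partial>M)"
proof -
  have [measurable]: "h \<in> borel_measurable M" using h by auto
  have "emeasure (density M h) (space (density M h)) = 1"
    using h by (simp add: emeasure_density nn_integral_eq_integral cong: nn_integral_cong)
  then interpret d: prob_space "density M h" by (rule prob_spaceI)
  show "real_distribution (distr (density M h) borel Y)"
    by (rule d.real_distribution_distr) simp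
  show "char (distr (density M h) borel Y) t = (CLINT \<omega>|M. h \<omega> *\<^sub>R iexp (t * Y \<omega>))"
    unfolding char_def by (simp add: integral_distr integral_density h)
  assume [measurable]: "B \<in> sets borel"
  have "measure (distr (density M h) borel Y) B = (\<integral>\<omega>. indicator B \<omega> \<partial>distr (density M h) borel Y)"
    by simp
  also have "\<dots> = (\<integral>\<omega>. h \<omega> *\<^sub>R indicator B (Y \<omega>) \<partial>M)"
    by (simp add: integral_distr integral_density h del: Bochner_Integration.integral_indicator integral_indicator)
  finally show "measure (distr (density M h) borel Y) B = (\<integral>\<omega>. indicator B (Y \<omega>) * h \<omega> \<partial>M)"
    by (simp add: mult.commute)
qed

text \<open>A signed weight of mean 0 is a difference of two nonnegative ones of equal mass. After
  normalisation the vanishing transform says that the two weighted laws of \<open>Y\<close> have the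
  same characteristic function, so they coincide.\<close>

lemma (in prob_space) fourier_zero_real:
  fixes V Y :: "'a \<Rightarrow> real"
  assumes Y[measurable]: "Y \<in> borel_measurable M" and V: "integrable M V"
    and zero: "\<And>t. (CLINT \<omega>|M. V \<omega> *\<^sub>R iexp (t * Y \<omega>)) = 0"
    and B[measurable]: "B \<in> sets borel"
  shows "(\<integral>\<omega>. indicator B (Y \<omega>) * V \<omega> \<partial>M) = 0"
proof -
  define c where "c = expectation (\<lambda>\<omega>. max (V \<omega>) 0)"
  \<comment> \<open>The added 1 keeps the normaliser \<open>c + 1\<close> positive even when
    \<open>V\<close> is 0 almost surely; it cancels in \<open>f - g\<close>.\<close>
  define f where "f \<omega> = (max (V \<omega>) 0 + 1) / (c + 1)" for \<omega>
  define g where "g \<omega> = (max (- V \<omega>) 0 + 1) / (c + 1)" for \<omega>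
  have [measurable]: "V \<in> borel_measurable M" using V by auto
  have c: "c \<ge> 0" unfolding c_def by (rule integral_nonneg_AE) auto
  have ip: "integrable M (\<lambda>\<omega>. max (V \<omega>) 0)" "integrable M (\<lambda>\<omega>. max (- V \<omega>) 0)"
    using V by auto
  \<comment> \<open>Frequency 0 shows that \<open>V\<close> has mean 0, so its positive and negative
    parts share the mass \<open>c\<close> and one normaliser serves both.\<close>
  have "complex_of_real (expectation V) = 0"
    using zero[of 0] by (simp add: scaleR_conv_of_real)
  moreover have "expectation V = expectation (\<lambda>\<omega>. max (V \<omega>) 0 - max (- V \<omega>) 0)"
    by (intro Bochner_Integration.integral_cong) auto
  ultimately have c': "expectation (\<lambda>\<omega>. max (- V \<omega>) 0) = c"
    using ip by (simp add: c_def)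
  have f: "integrable M f" "\<And>\<omega>. 0 \<le> f \<omega>" "expectation f = 1"
    using ip c by (auto simp: f_def[abs_def] prob_space c_def[symmetric])
  have g: "integrable M g" "\<And>\<omega>. 0 \<le> g \<omega>" "expectation g = 1"
    using ip c c' by (auto simp: g_def[abs_def] prob_space)
  have fg: "V \<omega> = (c + 1) * (f \<omega> - g \<omega>)" for \<omega>
  proof -
    have "f \<omega> - g \<omega> = V \<omega> / (c + 1)"
      by (simp add: f_def g_def max_def flip: diff_divide_distrib)
    then show ?thesis using c by simp
  qed
  have ii: "integrable M (\<lambda>\<omega>. h \<omega> *\<^sub>R iexp (t * Y \<omega>))" if "integrable M h" for h :: "'a \<Rightarrow> real" and t
    using that by (intro integrableI_bounded)
       (auto simp: integrable_iff_bounded)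
  have ib: "integrable M (\<lambda>\<omega>. indicator B (Y \<omega>) * h \<omega>)" if "integrable M h" for h :: "'a \<Rightarrow> real"
    by (rule Bochner_Integration.integrable_bound[OF that]) (use that in \<open>auto simp: indicator_def\<close>)
  have "char (distr (density M f) borel Y) t = char (distr (density M g) borel Y) t" for t
  proof -
    have "0 = (CLINT \<omega>|M. (c + 1) *\<^sub>R (f \<omega> *\<^sub>R iexp (t * Y \<omega>) - g \<omega> *\<^sub>R iexp (t * Y \<omega>)))"
      unfolding zero[of t, symmetric]
      by (intro Bochner_Integration.integral_cong) (auto simp: fg scaleR_conv_of_real algebra_simps)
    also have "\<dots> = (c + 1) *\<^sub>R ((CLINT \<omega>|M. f \<omega> *\<^sub>R iexp (t * Y \<omega>)) - (CLINT \<omega>|M. g \<omega> *\<^sub>R iexp (t * Y \<omega>)))"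
      by (simp only: integral_scaleR_right Bochner_Integration.integral_diff[OF ii ii, OF f(1) g(1)])
    finally show ?thesis
      using c distr_density_prob(2)[OF Y f] distr_density_prob(2)[OF Y g] by simp
  qed
  then have "distr (density M f) borel Y = distr (density M g) borel Y"
    by (intro Levy_uniqueness distr_density_prob[OF Y] f g) auto
  then have "(\<integral>\<omega>. indicator B (Y \<omega>) * f \<omega> \<partial>M) = (\<integral>\<omega>. indicator B (Y \<omega>) * g \<omega> \<partial>M)"
    using distr_density_prob(3)[OF Y f B] distr_density_prob(3)[OF Y g B] by simp
  then have "0 = (\<integral>\<omega>. (c + 1) * (indicator B (Y \<omega>) * f \<omega> - indicator B (Y \<omega>) * g \<omega>) \<partial>M)"
    by (simp add: ib f g)
  also have "\<dots> = (\<integral>\<omega>. indicator B (Y \<omega>) * V \<omega> \<partial>M)"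
    by (intro Bochner_Integration.integral_cong) (auto simp: fg algebra_simps)
  finally show ?thesis by simp
qed

text \<open>Complex weights arise once the exponentials of other coordinates are absorbed into
  \<open>V\<close>. The real case is applied to the real and the imaginary part, which are
  combinations of \<open>V\<close> and its conjugate.\<close>

lemma (in prob_space) fourier_zero_complex:
  fixes V :: "'a \<Rightarrow> complex" and Y :: "'a \<Rightarrow> real"
  assumes Y[measurable]: "Y \<in> borel_measurable M" and V: "integrable M V"
    and zero: "\<And>t. (CLINT \<omega>|M. V \<omega> * iexp (t * Y \<omega>)) = 0"
    and B[measurable]: "B \<in> sets borel"
  shows "(CLINT \<omega>|M. V \<omega> * indicator B (Y \<omega>)) = 0"
proof -
  have [measurable]: "V \<in> borel_measurable M" using V by auto
  have ii: "integrable M (\<lambda>\<omega>. h \<omega> * iexp (t * Y \<omega>))" if "integrable M h" for h :: "'a \<Rightarrow> complex" and t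
    using that by (intro integrableI_bounded) (auto simp: integrable_iff_bounded norm_mult)
  have ib: "integrable M (\<lambda>\<omega>. h \<omega> * indicator B (Y \<omega>))" if "integrable M h" for h :: "'a \<Rightarrow> complex"
    by (rule Bochner_Integration.integrable_bound[OF that]) (use that in \<open>auto simp: indicator_def\<close>)
  have V': "integrable M (\<lambda>\<omega>. cnj (V \<omega>))"
    using V by simp
  \<comment> \<open>The transform of the conjugate at \<open>t\<close> is the conjugate of the
    transform of \<open>V\<close> at \<open>- t\<close>, which vanishes as well.\<close>
  have cn: "(CLINT \<omega>|M. cnj (V \<omega>) * iexp (t * Y \<omega>)) = 0" for t
  proof -
    have "(CLINT \<omega>|M. cnj (V \<omega>) * iexp (t * Y \<omega>)) = (CLINT \<omega>|M. cnj (V \<omega> * iexp (- t * Y \<omega>)))"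
      by (intro Bochner_Integration.integral_cong) (auto simp: exp_cnj)
    also have "\<dots> = cnj (CLINT \<omega>|M. V \<omega> * iexp (- t * Y \<omega>))"
      by (rule Bochner_Integration.integral_cnj)
    finally show ?thesis
      by (simp only: zero complex_cnj_zero)
  qed
  have re: "(\<integral>\<omega>. indicator B (Y \<omega>) * Re (V \<omega>) \<partial>M) = 0"
  proof (rule fourier_zero_real[OF Y _ _ B])
    fix t
    have "(CLINT \<omega>|M. Re (V \<omega>) *\<^sub>R iexp (t * Y \<omega>)) =
        (CLINT \<omega>|M. (V \<omega> * iexp (t * Y \<omega>) + cnj (V \<omega>) * iexp (t * Y \<omega>)) / 2)"
      by (intro Bochner_Integration.integral_cong)
         (auto simp: scaleR_conv_of_real complex_add_cnj simp flip: distrib_right)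
    also have "\<dots> = ((CLINT \<omega>|M. V \<omega> * iexp (t * Y \<omega>)) + (CLINT \<omega>|M. cnj (V \<omega>) * iexp (t * Y \<omega>))) / 2"
      by (simp only: Bochner_Integration.integral_divide_zero Bochner_Integration.integral_add[OF ii ii, OF V V'])
    finally show "(CLINT \<omega>|M. Re (V \<omega>) *\<^sub>R iexp (t * Y \<omega>)) = 0"
      by (simp only: zero cn) simp
  qed (use V in auto)
  have im: "(\<integral>\<omega>. indicator B (Y \<omega>) * Im (V \<omega>) \<partial>M) = 0"
  proof (rule fourier_zero_real[OF Y _ _ B])
    fix t
    have "(CLINT \<omega>|M. Im (V \<omega>) *\<^sub>R iexp (t * Y \<omega>)) =
        (CLINT \<omega>|M. (V \<omega> * iexp (t * Y \<omega>) - cnj (V \<omega>) * iexp (t * Y \<omega>)) / (2 * \<i>))"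
    proof (intro Bochner_Integration.integral_cong refl)
      fix \<omega>
      have "(V \<omega> - cnj (V \<omega>)) / (2 * \<i>) = Im (V \<omega>)"
        by (simp add: complex_eq_iff complex_diff_cnj)
      then show "Im (V \<omega>) *\<^sub>R iexp (t * Y \<omega>) = (V \<omega> * iexp (t * Y \<omega>) - cnj (V \<omega>) * iexp (t * Y \<omega>)) / (2 * \<i>)"
        by (simp only: scaleR_conv_of_real left_diff_distrib[symmetric] times_divide_eq_left[symmetric])
    qed
    also have "\<dots> = ((CLINT \<omega>|M. V \<omega> * iexp (t * Y \<omega>)) - (CLINT \<omega>|M. cnj (V \<omega>) * iexp (t * Y \<omega>))) / (2 * \<i>)"
      by (simp only: Bochner_Integration.integral_divide_zero Bochner_Integration.integral_diff[OF ii ii, OF V V'])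
    finally show "(CLINT \<omega>|M. Im (V \<omega>) *\<^sub>R iexp (t * Y \<omega>)) = 0"
      by (simp only: zero cn) simp
  qed (use V in auto)
  have r: "Re (V \<omega> * indicator B (Y \<omega>)) = indicator B (Y \<omega>) * Re (V \<omega>)"
    "Im (V \<omega> * indicator B (Y \<omega>)) = indicator B (Y \<omega>) * Im (V \<omega>)" for \<omega>
    by (auto simp: indicator_def)
  show ?thesis
    using integral_Re[OF ib[OF V]] integral_Im[OF ib[OF V]]
    by (simp only: r re im complex_eq_iff) simp
qed

text \<open>With the frequencies of the other coordinates fixed, their exponential is absorbed into
  the weight, and the one-dimensional result replaces the exponential in coordinate \<open>j\<close>
  by \<open>indicator (B j)\<close>. The weight \<open>V\<close> times this indicator then satisfies
  the hypothesis over \<open>I\<close>, which is why the induction generalises over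
  \<open>V\<close>.\<close>

lemma (in prob_space) fourier_zero_rectangle:
  fixes V :: "'a \<Rightarrow> complex" and Y :: "'i \<Rightarrow> 'a \<Rightarrow> real"
  assumes "finite I" and "\<And>i. i \<in> I \<Longrightarrow> Y i \<in> borel_measurable M" and "integrable M V"
    and "\<And>u. (CLINT \<omega>|M. V \<omega> * iexp (\<Sum>i\<in>I. u i * Y i \<omega>)) = 0"
    and "\<And>i. i \<in> I \<Longrightarrow> B i \<in> sets borel"
  shows "(CLINT \<omega>|M. V \<omega> * (\<Prod>i\<in>I. indicator (B i) (Y i \<omega>))) = 0"
  using assms
proof (induction I arbitrary: V rule: finite_induct)
  case empty
  then show ?case by simp
next
  case (insert j I)
  have Yj[measurable]: "Y j \<in> borel_measurable M" and [measurable]: "B j \<in> sets borel"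
    and [measurable]: "V \<in> borel_measurable M"
    using insert.prems by auto
  have [measurable]: "(\<lambda>\<omega>. \<Sum>i\<in>I. u i * Y i \<omega>) \<in> borel_measurable M" for u :: "'i \<Rightarrow> real"
    using insert.prems by (intro borel_measurable_sum borel_measurable_times) auto
  have "(CLINT \<omega>|M. (V \<omega> * indicator (B j) (Y j \<omega>)) * (\<Prod>i\<in>I. indicator (B i) (Y i \<omega>))) = 0"
  proof (rule insert.IH)
    show "integrable M (\<lambda>\<omega>. V \<omega> * indicator (B j) (Y j \<omega>))"
      by (rule Bochner_Integration.integrable_bound[OF insert.prems(2)]) (auto simp: indicator_def)
    fix u :: "'i \<Rightarrow> real"
    have "(CLINT \<omega>|M. (V \<omega> * iexp (\<Sum>i\<in>I. u i * Y i \<omega>)) * indicator (B j) (Y j \<omega>)) = 0"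
    proof (rule fourier_zero_complex[OF Yj])
      show "integrable M (\<lambda>\<omega>. V \<omega> * iexp (\<Sum>i\<in>I. u i * Y i \<omega>))"
      proof (rule Bochner_Integration.integrable_bound[OF insert.prems(2)])
        show "AE \<omega> in M. norm (V \<omega> * iexp (\<Sum>i\<in>I. u i * Y i \<omega>)) \<le> norm (V \<omega>)"
          by (simp add: norm_mult del: of_real_sum)
      qed measurable
      fix t :: real
      \<comment> \<open>Varying only the frequency at \<open>j\<close>, with \<open>u\<close> fixed
        on \<open>I\<close>, sweeps out the one-dimensional transform in \<open>Y j\<close>.\<close>
      have "(CLINT \<omega>|M. V \<omega> * iexp (\<Sum>i\<in>I. u i * Y i \<omega>) * iexp (t * Y j \<omega>))
        = (CLINT \<omega>|M. V \<omega> * iexp (\<Sum>i\<in>insert j I. (u(j := t)) i * Y i \<omega>))"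
      proof (intro Bochner_Integration.integral_cong refl)
        fix \<omega>
        have "(\<Sum>i\<in>insert j I. (u(j := t)) i * Y i \<omega>) = t * Y j \<omega> + (\<Sum>i\<in>I. u i * Y i \<omega>)"
          using insert.hyps by (auto intro!: sum.cong)
        then show "V \<omega> * iexp (\<Sum>i\<in>I. u i * Y i \<omega>) * iexp (t * Y j \<omega>) =
            V \<omega> * iexp (\<Sum>i\<in>insert j I. (u(j := t)) i * Y i \<omega>)"
          by (simp only:) (simp add: exp_add algebra_simps)
      qed
      then show "(CLINT \<omega>|M. V \<omega> * iexp (\<Sum>i\<in>I. u i * Y i \<omega>) * iexp (t * Y j \<omega>)) = 0"
        using insert.prems(3) by simp
    qed simp
    then show "(CLINT \<omega>|M. V \<omega> * indicator (B j) (Y j \<omega>) * iexp (\<Sum>i\<in>I. u i * Y i \<omega>)) = 0"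
      by (simp add: mult_ac)
  qed (use insert.prems in auto)
  then show ?case
    using insert.hyps by (simp add: mult_ac)
qed

section \<open>Sigma-algebras generated by families of variables\<close>

lemma sets_gen_sigma:
  "sets (gen_sigma M Y I) = sigma_sets (space M) (\<Union>j\<in>I. {Y j -` A \<inter> space M |A. A \<in> sets borel})"
  unfolding gen_sigma_def by (intro sets_measure_of) auto

lemma space_gen_sigma [simp]: "space (gen_sigma M Y I) = space M"
  unfolding gen_sigma_def by (intro space_measure_of) auto

lemma measurable_gen_sigma: "i \<in> I \<Longrightarrow> Y i \<in> borel_measurable (gen_sigma M Y I)"
  by (intro measurableI) (auto simp: sets_gen_sigma)

lemma sets_gen_sigma_least:
  assumes "space N = space M" "\<And>i. i \<in> I \<Longrightarrow> Y i \<in> borel_measurable N"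
  shows "sets (gen_sigma M Y I) \<subseteq> sets N"
proof -
  have "(\<Union>j\<in>I. {Y j -` A \<inter> space M |A. A \<in> sets borel}) \<subseteq> sets N"
    using measurable_sets[OF assms(2)] assms(1) by auto
  then show ?thesis
    unfolding sets_gen_sigma assms(1)[symmetric] by (rule sets.sigma_sets_subset)
qed

lemma subalgebra_gen_sigma:
  assumes "\<And>i. i \<in> I \<Longrightarrow> Y i \<in> borel_measurable M"
  shows "subalgebra M (gen_sigma M Y I)"
  using sets_gen_sigma_least[of M M I Y] assms by (auto simp: subalgebra_def)

text \<open>Dynkin's pi-lambda argument: rectangles in the variables \<open>Y i\<close> are stable
  under intersection and generate the sigma-algebra, and the sets over which \<open>V\<close>
  integrates to 0 are closed under complements and countable disjoint unions.\<close>

lemma (in prob_space) fourier_zero_gen_sigma: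
  fixes V :: "'a \<Rightarrow> complex" and Y :: "'i \<Rightarrow> 'a \<Rightarrow> real"
  assumes I: "finite I" and Y: "\<And>i. i \<in> I \<Longrightarrow> Y i \<in> borel_measurable M" and V: "integrable M V"
    and zero: "\<And>u. (CLINT \<omega>|M. V \<omega> * iexp (\<Sum>i\<in>I. u i * Y i \<omega>)) = 0"
    and A: "A \<in> sets (gen_sigma M Y I)"
  shows "(CLINT \<omega>|M. V \<omega> * indicator A \<omega>) = 0"
proof -
  define G where "G = {{\<omega> \<in> space M. \<forall>i\<in>I. Y i \<omega> \<in> B i} |B. \<forall>i. B i \<in> sets (borel :: real measure)}"
  have G_M: "G \<subseteq> sets M"
  proof
    fix E assume "E \<in> G"
    then obtain B where B: "E = {\<omega> \<in> space M. \<forall>i\<in>I. Y i \<omega> \<in> B i}" "\<forall>i. B i \<in> sets borel"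
      by (auto simp: G_def)
    show "E \<in> sets M"
      unfolding B(1) using I Y B(2) by (intro sets.sets_Collect_finite_All) (auto intro: measurable_sets_Collect)
  qed
  have "Int_stable G"
  proof (rule Int_stableI)
    fix E E' assume "E \<in> G" "E' \<in> G"
    then obtain B B' where "E = {\<omega> \<in> space M. \<forall>i\<in>I. Y i \<omega> \<in> B i}" "\<forall>i. B i \<in> sets borel"
      "E' = {\<omega> \<in> space M. \<forall>i\<in>I. Y i \<omega> \<in> B' i}" "\<forall>i. B' i \<in> sets borel"
      by (auto simp: G_def)
    then show "E \<inter> E' \<in> G"
      unfolding G_def by (intro CollectI exI[of _ "\<lambda>i. B i \<inter> B' i"]) auto
  qed
  \<comment> \<open>A generator constrains one variable only: it is the rectangle whose other sides
    are all \<open>UNIV\<close>.\<close>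
  have gen: "(\<Union>j\<in>I. {Y j -` A \<inter> space M |A. A \<in> sets borel}) \<subseteq> G"
  proof safe
    fix j and A :: "real set" assume "j \<in> I" "A \<in> sets borel"
    then show "Y j -` A \<inter> space M \<in> G"
      unfolding G_def by (intro CollectI exI[of _ "\<lambda>i. if i = j then A else UNIV"]) auto
  qed
  have A': "A \<in> sigma_sets (space M) G"
    using A sigma_sets_mono'[OF gen] by (auto simp: sets_gen_sigma)
  have sM: "sigma_sets (space M) G \<subseteq> sets M"
    using G_M by (rule sets.sigma_sets_subset)
  have [measurable]: "V \<in> borel_measurable M" using V by auto
  have int: "integrable M (\<lambda>\<omega>. V \<omega> * indicator E \<omega>)" if [measurable]: "E \<in> sets M" for E
    by (rule Bochner_Integration.integrable_bound[OF V]) (auto simp: indicator_def)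
  have sc: "indicat_real E \<omega> *\<^sub>R V \<omega> = V \<omega> * indicator E \<omega>" for E \<omega>
    by (simp add: indicator_def)
  \<comment> \<open>All frequencies 0 give total integral 0, on which the complement case
    rests.\<close>
  have V0: "(CLINT \<omega>|M. V \<omega>) = 0"
    using zero[of "\<lambda>_. 0"] by simp
  have "G \<subseteq> Pow (space M)" by (auto simp: G_def)
  from \<open>Int_stable G\<close> this A' show ?thesis
  proof (induction A rule: sigma_sets_induct_disjoint)
    case (basic A)
    then obtain B where B: "A = {\<omega> \<in> space M. \<forall>i\<in>I. Y i \<omega> \<in> B i}" "\<forall>i. B i \<in> sets borel"
      by (auto simp: G_def)
    have "(CLINT \<omega>|M. V \<omega> * indicator A \<omega>) = (CLINT \<omega>|M. V \<omega> * (\<Prod>i\<in>I. indicator (B i) (Y i \<omega>)))"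
    proof (intro Bochner_Integration.integral_cong refl)
      fix \<omega> assume "\<omega> \<in> space M"
      then have "(indicator A \<omega> :: complex) = (\<Prod>i\<in>I. indicator (B i) (Y i \<omega>))"
        using I by (auto simp: B(1) indicator_def)
      then show "V \<omega> * indicator A \<omega> = V \<omega> * (\<Prod>i\<in>I. indicator (B i) (Y i \<omega>))" by simp
    qed
    also have "\<dots> = 0"
      using fourier_zero_rectangle[OF I Y V zero] B(2) by blast
    finally show ?case .
  next
    case empty
    then show ?case by simp
  next
    case (compl A)
    have [measurable]: "A \<in> sets M" using compl sM by auto
    have "(CLINT \<omega>|M. V \<omega> * indicator (space M - A) \<omega>) = (CLINT \<omega>|M. V \<omega> - V \<omega> * indicator A \<omega>)"
      by (intro Bochner_Integration.integral_cong) (auto simp: indicator_def)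
    then show ?case
      using compl V V0 by (simp add: int)
  next
    case (union A)
    then have [measurable]: "A i \<in> sets M" for i using sM by auto
    have "set_integrable M (\<Union>i. A i) V"
      using int[of "\<Union>i. A i"] by (simp add: set_integrable_def sc)
    then have "(CLINT \<omega>:(\<Union>i. A i)|M. V \<omega>) = (\<Sum>i. (CLINT \<omega>:A i|M. V \<omega>))"
      using union by (intro lebesgue_integral_countable_add) (auto simp: disjoint_family_on_def)
    then show ?case
      using union by (simp add: set_lebesgue_integral_def sc)
  qed
qed

section \<open>Gaussian spaces\<close>

text \<open>The parameter \<open>v\<close> is the second moment, also in the degenerate case, so the
  second moment determines the characteristic function. Frequency 1 is enough because the Gaussian
  spaces below are closed under scaling.\<close>

lemma (in prob_space) real_gaussian0_moments:
  assumes "real_gaussian0 M X v"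
  shows "integrable M (\<lambda>\<omega>. (X \<omega>)\<^sup>2)" and "expectation X = 0" and "expectation (\<lambda>\<omega>. (X \<omega>)\<^sup>2) = v"
    and "(CLINT \<omega>|M. iexp (X \<omega>)) = exp (- v / 2)"
proof -
  have X[measurable]: "X \<in> borel_measurable M"
    using assms by (simp add: real_gaussian0_def)
  consider "v = 0" "AE \<omega> in M. X \<omega> = 0" | "0 < v" "distributed M lborel X (normal_density 0 (sqrt v))"
    using assms by (auto simp: real_gaussian0_def)
  then have "integrable M (\<lambda>\<omega>. (X \<omega>)\<^sup>2) \<and> expectation X = 0 \<and> expectation (\<lambda>\<omega>. (X \<omega>)\<^sup>2) = v \<and>
    (CLINT \<omega>|M. iexp (X \<omega>)) = exp (- v / 2)"
  proof cases
    case 1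
    have a: "AE \<omega> in M. (X \<omega>)\<^sup>2 = 0" "AE \<omega> in M. iexp (X \<omega>) = 1"
      using 1(2) by auto
    have "integrable M (\<lambda>\<omega>. (X \<omega>)\<^sup>2)"
      using a(1) by (subst integrable_cong_AE[where g = "\<lambda>_. 0"]) auto
    moreover have "expectation X = (\<integral>\<omega>. 0 \<partial>M)"
      using 1(2) by (intro integral_cong_AE) auto
    moreover have "expectation (\<lambda>\<omega>. (X \<omega>)\<^sup>2) = (\<integral>\<omega>. 0 \<partial>M)"
      using a(1) by (intro integral_cong_AE) auto
    moreover have "(CLINT \<omega>|M. iexp (X \<omega>)) = (CLINT \<omega>|M. 1)"
      using a(2) by (intro integral_cong_AE) auto
    ultimately show ?thesis
      using 1(1) by (simp add: prob_space)
  next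
    case 2
    define \<sigma> where "\<sigma> = sqrt v"
    have \<sigma>: "0 < \<sigma>" "\<sigma>\<^sup>2 = v" using 2(1) by (auto simp: \<sigma>_def)
    have D: "distributed M lborel X (normal_density 0 \<sigma>)" using 2(2) by (simp add: \<sigma>_def)
    have "integrable lborel (\<lambda>x. normal_density 0 \<sigma> x * x\<^sup>2)"
      using integrable_normal_moment[OF \<sigma>(1), of 0 2] by simp
    then have i: "integrable M (\<lambda>\<omega>. (X \<omega>)\<^sup>2)"
      by (subst (asm) distributed_integrable[OF D]) auto
    have m: "expectation X = 0"
      by (rule normal_distributed_expectation[OF \<sigma>(1) D])
    have v: "expectation (\<lambda>\<omega>. (X \<omega>)\<^sup>2) = v"
      using normal_distributed_variance[OF \<sigma>(1) D] m \<sigma>(2) by simp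
    \<comment> \<open>Division by \<open>\<sigma>\<close> makes the law standard normal; the
      standard characteristic function at \<open>\<sigma>\<close> is that of \<open>X\<close> at
      1.\<close>
    have "distributed M lborel (\<lambda>\<omega>. (X \<omega> - 0) / \<sigma>) std_normal_density"
      using D normal_standard_normal_convert[OF \<sigma>(1)] by blast
    then have "distr M lborel (\<lambda>\<omega>. X \<omega> / \<sigma>) = std_normal_distribution"
      by (simp add: distributed_def)
    then have "distr M borel (\<lambda>\<omega>. X \<omega> / \<sigma>) = std_normal_distribution"
      by (metis distr_cong sets_lborel)
    then have "char (distr M borel (\<lambda>\<omega>. X \<omega> / \<sigma>)) \<sigma> = exp (- v / 2)"
      by (simp add: char_std_normal_distribution \<sigma>)
    moreover have "char (distr M borel (\<lambda>\<omega>. X \<omega> / \<sigma>)) \<sigma> = (CLINT \<omega>|M. iexp (X \<omega>))"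
      using \<sigma>(1) by (simp add: char_def integral_distr flip: of_real_mult)
    ultimately show ?thesis
      using i m v by simp
  qed
  then show "integrable M (\<lambda>\<omega>. (X \<omega>)\<^sup>2)" and "expectation X = 0" and "expectation (\<lambda>\<omega>. (X \<omega>)\<^sup>2) = v"
    and "(CLINT \<omega>|M. iexp (X \<omega>)) = exp (- v / 2)"
    by auto
qed

text \<open>Summands of variance 0 vanish almost surely, so the sum agrees almost surely with the
  one over the indices of positive variance, and a sum of independent normals is normal.\<close>

lemma (in prob_space) real_gaussian0_sum:
  assumes I: "finite I" and ind: "indep_vars (\<lambda>_. borel) X I"
    and g: "\<And>i. i \<in> I \<Longrightarrow> real_gaussian0 M (X i) (v i)"
  shows "\<exists>w. real_gaussian0 M (\<lambda>\<omega>. \<Sum>i\<in>I. X i \<omega>) w"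
proof -
  define K where "K = {i \<in> I. 0 < v i}"
  have Xm: "X i \<in> borel_measurable M" if "i \<in> I" for i
    using g[OF that] by (simp add: real_gaussian0_def)
  have m: "(\<lambda>\<omega>. \<Sum>i\<in>I. X i \<omega>) \<in> borel_measurable M" "(\<lambda>\<omega>. \<Sum>i\<in>K. X i \<omega>) \<in> borel_measurable M"
    using Xm by (auto simp: K_def)
  have "AE \<omega> in M. \<forall>i\<in>I - K. X i \<omega> = 0"
    using I g by (intro AE_finite_allI) (auto simp: K_def real_gaussian0_def)
  then have eq: "AE \<omega> in M. (\<Sum>i\<in>I. X i \<omega>) = (\<Sum>i\<in>K. X i \<omega>)"
  proof eventually_elim
    case (elim \<omega>)
    then show ?case
      using I by (intro sum.mono_neutral_right) (auto simp: K_def)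
  qed
  \<comment> \<open>If every summand is degenerate, the sum is the Gaussian of variance 0; the
    addition theorem for normal densities asks for a nonempty index set.\<close>
  show ?thesis
  proof (cases "K = {}")
    case True
    then show ?thesis
      using m eq by (intro exI[of _ 0]) (simp add: real_gaussian0_def)
  next
    case False
    define w where "w = (\<Sum>i\<in>K. (sqrt (v i))\<^sup>2)"
    have "0 < w"
      using False I unfolding w_def by (intro sum_pos) (auto simp: K_def)
    have "distributed M lborel (\<lambda>\<omega>. \<Sum>i\<in>K. X i \<omega>) (normal_density (\<Sum>i\<in>K. 0) (sqrt w))"
      unfolding w_def
    proof (rule sum_indep_normal)
      show "indep_vars (\<lambda>_. borel) X K"
        by (rule indep_vars_subset[OF ind]) (auto simp: K_def)
      show "distributed M lborel (X i) (normal_density 0 (sqrt (v i)))" if "i \<in> K" for i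
        using that g[of i] by (auto simp: K_def real_gaussian0_def)
    qed (use I False in \<open>auto simp: K_def\<close>)
    moreover have "distr M lborel (\<lambda>\<omega>. \<Sum>i\<in>I. X i \<omega>) = distr M lborel (\<lambda>\<omega>. \<Sum>i\<in>K. X i \<omega>)"
      using m eq by (intro distr_cong_AE) auto
    ultimately have "distributed M lborel (\<lambda>\<omega>. \<Sum>i\<in>I. X i \<omega>) (normal_density 0 (sqrt w))"
      using m by (simp add: distributed_def)
    with \<open>0 < w\<close> show ?thesis
      using m by (intro exI[of _ w]) (simp add: real_gaussian0_def)
  qed
qed

lemma integrable_mult_square_integrable:
  fixes f g :: "'a \<Rightarrow> real"
  assumes [measurable]: "f \<in> borel_measurable M" "g \<in> borel_measurable M"
    and "integrable M (\<lambda>\<omega>. (f \<omega>)\<^sup>2)" "integrable M (\<lambda>\<omega>. (g \<omega>)\<^sup>2)"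
  shows "integrable M (\<lambda>\<omega>. f \<omega> * g \<omega>)"
proof (rule Bochner_Integration.integrable_bound)
  show "integrable M (\<lambda>\<omega>. (f \<omega>)\<^sup>2 + (g \<omega>)\<^sup>2)"
    using assms by auto
  have "\<bar>a * b\<bar> \<le> a\<^sup>2 + b\<^sup>2" for a b :: real
  proof -
    have "0 \<le> \<bar>a\<bar> * \<bar>b\<bar>" by simp
    then show ?thesis
      using sum_squares_bound[of "\<bar>a\<bar>" "\<bar>b\<bar>"] by (simp only: abs_mult power2_abs)
  qed
  then show "AE \<omega> in M. norm (f \<omega> * g \<omega>) \<le> norm ((f \<omega>)\<^sup>2 + (g \<omega>)\<^sup>2)"
    by simp
qed simp

text \<open>Joint Gaussianity is encoded by closure: every linear combination of members is again a
  centred Gaussian variable, as in the Cramer-Wold characterisation. Covariances are then plain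
  expectations of products.\<close>

locale gaussian_space = prob_space M for M :: "'a measure" +
  fixes H :: "('a \<Rightarrow> real) set"
  assumes gaussian: "X \<in> H \<Longrightarrow> \<exists>v. real_gaussian0 M X v"
    and zero_mem: "(\<lambda>_. 0) \<in> H"
    and add_mem: "X \<in> H \<Longrightarrow> Y \<in> H \<Longrightarrow> (\<lambda>\<omega>. X \<omega> + Y \<omega>) \<in> H"
    and scale_mem: "X \<in> H \<Longrightarrow> (\<lambda>\<omega>. a * X \<omega>) \<in> H"
begin

lemma measurable_mem: "X \<in> H \<Longrightarrow> X \<in> borel_measurable M"
  using gaussian by (auto simp: real_gaussian0_def)

lemma square_integrable_mem: "X \<in> H \<Longrightarrow> integrable M (\<lambda>\<omega>. (X \<omega>)\<^sup>2)"
  using gaussian real_gaussian0_moments(1) by blast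

lemma expectation_mem: "X \<in> H \<Longrightarrow> expectation X = 0"
  using gaussian real_gaussian0_moments(2) by blast

lemma iexp_mem: "X \<in> H \<Longrightarrow> (CLINT \<omega>|M. iexp (X \<omega>)) = exp (- expectation (\<lambda>\<omega>. (X \<omega>)\<^sup>2) / 2)"
  using gaussian real_gaussian0_moments(3,4) by metis

lemma integrable_mult_mem: "X \<in> H \<Longrightarrow> Y \<in> H \<Longrightarrow> integrable M (\<lambda>\<omega>. X \<omega> * Y \<omega>)"
  by (intro integrable_mult_square_integrable measurable_mem square_integrable_mem)

lemma integrable_mem: "X \<in> H \<Longrightarrow> integrable M X"
  using integrable_mult_square_integrable[of X M "\<lambda>_. 1"]
  by (simp add: measurable_mem square_integrable_mem)

lemma sum_mem: "(\<And>i. i \<in> I \<Longrightarrow> Y i \<in> H) \<Longrightarrow> (\<lambda>\<omega>. \<Sum>i\<in>I. u i * Y i \<omega>) \<in> H"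
proof (induction I rule: infinite_finite_induct)
  case (insert i I)
  then show ?case
    using add_mem[OF scale_mem[of "Y i" "u i"]] by simp
qed (auto intro: zero_mem)

lemma diff_scale_mem: "X \<in> H \<Longrightarrow> Y \<in> H \<Longrightarrow> (\<lambda>\<omega>. X \<omega> - a * Y \<omega>) \<in> H"
  using add_mem[OF _ scale_mem, of X Y "- a"] by simp

lemma diff_sum_mem: "X \<in> H \<Longrightarrow> (\<And>i. i \<in> I \<Longrightarrow> Y i \<in> H) \<Longrightarrow> (\<lambda>\<omega>. X \<omega> - (\<Sum>i\<in>I. u i * Y i \<omega>)) \<in> H"
  using diff_scale_mem[OF _ sum_mem, of X I Y 1] by simp

lemma expectation_mult_sum:
  assumes "Z \<in> H" "\<And>i. i \<in> I \<Longrightarrow> Y i \<in> H"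
  shows "expectation (\<lambda>\<omega>. Z \<omega> * (\<Sum>i\<in>I. u i * Y i \<omega>)) = (\<Sum>i\<in>I. u i * expectation (\<lambda>\<omega>. Z \<omega> * Y i \<omega>))"
proof -
  have "expectation (\<lambda>\<omega>. Z \<omega> * (\<Sum>i\<in>I. u i * Y i \<omega>)) = expectation (\<lambda>\<omega>. \<Sum>i\<in>I. u i * (Z \<omega> * Y i \<omega>))"
    by (simp add: sum_distrib_left mult_ac)
  also have "\<dots> = (\<Sum>i\<in>I. expectation (\<lambda>\<omega>. u i * (Z \<omega> * Y i \<omega>)))"
    using assms by (intro Bochner_Integration.integral_sum) (auto intro: integrable_mult_mem)
  finally show ?thesis by simp
qed

lemma expectation_mult_diff_scale:
  assumes "X \<in> H" "Y \<in> H" "Z \<in> H"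
  shows "expectation (\<lambda>\<omega>. (X \<omega> - a * Y \<omega>) * Z \<omega>) =
    expectation (\<lambda>\<omega>. X \<omega> * Z \<omega>) - a * expectation (\<lambda>\<omega>. Y \<omega> * Z \<omega>)"
proof -
  have "expectation (\<lambda>\<omega>. (X \<omega> - a * Y \<omega>) * Z \<omega>) = expectation (\<lambda>\<omega>. X \<omega> * Z \<omega> - a * (Y \<omega> * Z \<omega>))"
    by (simp add: algebra_simps)
  then show ?thesis
    using assms by (simp add: integrable_mult_mem)
qed

text \<open>The joint characteristic function factorises, so \<open>exp (i t W)\<close> minus its mean has vanishing
  Fourier transform against \<open>Y\<close>; then \<open>indicator A - P(A)\<close> has vanishing Fourier transform
  against \<open>W\<close>.\<close>
lemma uncorrelated_imp_integral_eq_0: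
  fixes Y :: "'i \<Rightarrow> 'a \<Rightarrow> real"
  assumes I: "finite I" and Y: "\<And>i. i \<in> I \<Longrightarrow> Y i \<in> H" and W: "W \<in> H"
    and orth: "\<And>i. i \<in> I \<Longrightarrow> expectation (\<lambda>\<omega>. W \<omega> * Y i \<omega>) = 0"
    and A: "A \<in> sets (gen_sigma M Y I)"
  shows "expectation (\<lambda>\<omega>. indicator A \<omega> * W \<omega>) = 0"
proof -
  have [measurable]: "W \<in> borel_measurable M" using W by (rule measurable_mem)
  have "subalgebra M (gen_sigma M Y I)"
    using Y measurable_mem by (intro subalgebra_gen_sigma) auto
  then have [measurable]: "A \<in> sets M"
    using A by (auto simp: subalgebra_def)
  define s where "s = expectation (\<lambda>\<omega>. (W \<omega>)\<^sup>2)"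
  define \<phi> :: "real \<Rightarrow> complex" where "\<phi> t = exp (- (t\<^sup>2 * s) / 2)" for t
  have bd: "integrable M f" if "f \<in> borel_measurable M" "\<And>\<omega>. norm (f \<omega>) \<le> c" for f :: "'a \<Rightarrow> complex" and c
    using that by (intro integrable_const_bound[of _ c]) auto
  have iW: "integrable M (\<lambda>\<omega>. iexp (t * W \<omega>))" for t
    by (rule bd[of _ 1]) auto
  have W\<phi>: "(CLINT \<omega>|M. iexp (t * W \<omega>)) = \<phi> t" for t
    using iexp_mem[OF scale_mem[OF W, of t]] by (simp add: \<phi>_def s_def power_mult_distrib)
  have *: "(CLINT \<omega>|M. (iexp (t * W \<omega>) - \<phi> t) * indicator A \<omega>) = 0" for t
  proof (rule fourier_zero_gen_sigma[OF I _ _ _ A])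
    show "Y i \<in> borel_measurable M" if "i \<in> I" for i
      using Y[OF that] by (rule measurable_mem)
    show "integrable M (\<lambda>\<omega>. iexp (t * W \<omega>) - \<phi> t)"
      using iW by (intro Bochner_Integration.integrable_diff) auto
    fix u :: "'i \<Rightarrow> real"
    define Z where "Z \<omega> = (\<Sum>i\<in>I. u i * Y i \<omega>)" for \<omega>
    have Z: "Z \<in> H" unfolding Z_def[abs_def] using Y by (rule sum_mem)
    have [measurable]: "Z \<in> borel_measurable M" using Z by (rule measurable_mem)
    have WZ: "expectation (\<lambda>\<omega>. W \<omega> * Z \<omega>) = 0"
      unfolding Z_def using expectation_mult_sum[OF W, of I Y u] Y orth by simp
    \<comment> \<open>Closure makes \<open>t * W + Z\<close> Gaussian, so its characteristic
      function is read off from its second moment, whose cross term vanishes by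
      \<open>WZ\<close>.\<close>
    have WZm: "(\<lambda>\<omega>. t * W \<omega> + Z \<omega>) \<in> H" by (intro add_mem scale_mem W Z)
    have "expectation (\<lambda>\<omega>. (t * W \<omega> + Z \<omega>)\<^sup>2) =
      expectation (\<lambda>\<omega>. t\<^sup>2 * (W \<omega>)\<^sup>2 + (2 * t) * (W \<omega> * Z \<omega>) + (Z \<omega>)\<^sup>2)"
      by (intro Bochner_Integration.integral_cong) (auto simp: power2_eq_square algebra_simps)
    also have "\<dots> = t\<^sup>2 * s + expectation (\<lambda>\<omega>. (Z \<omega>)\<^sup>2)"
      using W Z by (simp add: integrable_mult_mem square_integrable_mem WZ s_def)
    finally have "(CLINT \<omega>|M. iexp (t * W \<omega> + Z \<omega>)) = exp (- (t\<^sup>2 * s + expectation (\<lambda>\<omega>. (Z \<omega>)\<^sup>2)) / 2)"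
      using iexp_mem[OF WZm] by simp
    also have "\<dots> = \<phi> t * (CLINT \<omega>|M. iexp (Z \<omega>))"
      by (simp only: \<phi>_def iexp_mem[OF Z] of_real_mult[symmetric] exp_add[symmetric])
         (simp add: add_divide_distrib)
    finally have eq: "(CLINT \<omega>|M. iexp (t * W \<omega> + Z \<omega>)) = \<phi> t * (CLINT \<omega>|M. iexp (Z \<omega>))" .
    have i: "integrable M (\<lambda>\<omega>. iexp (t * W \<omega> + Z \<omega>))" "integrable M (\<lambda>\<omega>. \<phi> t * iexp (Z \<omega>))"
    proof -
      show "integrable M (\<lambda>\<omega>. iexp (t * W \<omega> + Z \<omega>))"
      proof (rule bd[of _ 1])
        show "norm (iexp (t * W \<omega> + Z \<omega>)) \<le> 1" for \<omega>
          by (simp del: of_real_add)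
      qed measurable
      show "integrable M (\<lambda>\<omega>. \<phi> t * iexp (Z \<omega>))"
        by (intro integrable_mult_right bd[of _ 1]) auto
    qed
    have "(CLINT \<omega>|M. (iexp (t * W \<omega>) - \<phi> t) * iexp (Z \<omega>)) =
        (CLINT \<omega>|M. iexp (t * W \<omega> + Z \<omega>) - \<phi> t * iexp (Z \<omega>))"
      by (intro Bochner_Integration.integral_cong) (auto simp: algebra_simps exp_add)
    also have "\<dots> = 0"
      by (simp only: Bochner_Integration.integral_diff[OF i] eq integral_mult_right_zero) simp
    finally show "(CLINT \<omega>|M. (iexp (t * W \<omega>) - \<phi> t) * iexp (\<Sum>i\<in>I. u i * Y i \<omega>)) = 0"
      by (simp only: Z_def)
  qed
  define V where "V \<omega> = indicator A \<omega> - prob A" for \<omega>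
  have V: "integrable M V" unfolding V_def[abs_def]
    by (intro Bochner_Integration.integrable_diff integrable_real_indicator) (auto simp: emeasure_eq_measure)
  have [measurable]: "V \<in> borel_measurable M" using V by auto
  have Vt: "(CLINT \<omega>|M. V \<omega> *\<^sub>R iexp (t * W \<omega>)) = 0" for t
  proof -
    have i: "integrable M (\<lambda>\<omega>. (iexp (t * W \<omega>) - \<phi> t) * indicator A \<omega>)"
      "integrable M (\<lambda>\<omega>. \<phi> t * indicator A \<omega>)" "integrable M (\<lambda>\<omega>. prob A * iexp (t * W \<omega>))"
    proof -
      show "integrable M (\<lambda>\<omega>. (iexp (t * W \<omega>) - \<phi> t) * indicator A \<omega>)"
      proof (rule Bochner_Integration.integrable_bound)
        show "integrable M (\<lambda>\<omega>. iexp (t * W \<omega>) - \<phi> t)"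
          using iW by (intro Bochner_Integration.integrable_diff) auto
      qed (measurable, auto simp: indicator_def)
      show "integrable M (\<lambda>\<omega>. \<phi> t * indicator A \<omega>)"
        by (intro integrable_mult_right bd[of _ 1]) (measurable, auto simp: indicator_def)
      show "integrable M (\<lambda>\<omega>. prob A * iexp (t * W \<omega>))"
        using iW by (intro integrable_mult_right)
    qed
    have "(CLINT \<omega>|M. V \<omega> *\<^sub>R iexp (t * W \<omega>)) =
      (CLINT \<omega>|M. (iexp (t * W \<omega>) - \<phi> t) * indicator A \<omega> + \<phi> t * indicator A \<omega> - prob A * iexp (t * W \<omega>))"
      by (intro Bochner_Integration.integral_cong refl)
         (auto simp: V_def scaleR_conv_of_real algebra_simps indicator_def)
    also have "\<dots> = 0 + \<phi> t * (CLINT \<omega>|M. indicator A \<omega>) - prob A * \<phi> t"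
      by (simp only: Bochner_Integration.integral_diff[OF Bochner_Integration.integrable_add[OF i(1,2)] i(3)]
          Bochner_Integration.integral_add[OF i(1,2)] * W\<phi> integral_mult_right_zero)
    also have "(CLINT \<omega>|M. indicator A \<omega>) = (CLINT \<omega>|M. of_real (indicator A \<omega>))"
      by (intro Bochner_Integration.integral_cong) (auto simp: indicator_def)
    also have "\<dots> = prob A"
      by (subst integral_complex_of_real) simp
    finally show ?thesis by simp
  qed
  \<comment> \<open>Passing from indicators of events of \<open>W\<close> to \<open>W\<close> itself
    gives covariance 0 between \<open>W\<close> and \<open>V\<close>. Since \<open>W\<close> is
    centred, the constant \<open>prob A\<close> inside \<open>V\<close> contributes nothing.\<close>
  have "expectation (\<lambda>\<omega>. W \<omega> * V \<omega>) = 0"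
  proof (rule integral_mult_eq_0_vimage[where g = "\<lambda>x. x" and X = W and V = V])
    fix B :: "real set" assume B: "B \<in> sets borel"
    have "(\<integral>\<omega>. indicator (W -` B \<inter> space M) \<omega> * V \<omega> \<partial>M) = (\<integral>\<omega>. indicator B (W \<omega>) * V \<omega> \<partial>M)"
      by (intro Bochner_Integration.integral_cong) (auto simp: indicator_def)
    also have "\<dots> = 0"
      by (rule fourier_zero_real[OF _ V Vt B]) simp
    finally show "(\<integral>\<omega>. indicator (W -` B \<inter> space M) \<omega> * V \<omega> \<partial>M) = 0" .
  next
    show "integrable M (\<lambda>\<omega>. W \<omega> * V \<omega>)"
      by (rule Bochner_Integration.integrable_bound[OF integrable_mem[OF W]])
         (auto simp: V_def indicator_def abs_mult intro!: mult_left_le)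
  qed (use V in auto)
  moreover have "integrable M (\<lambda>\<omega>. indicator A \<omega> * W \<omega>)"
    using integrable_mult_indicator[OF _ integrable_mem[OF W], of A] by simp
  ultimately show ?thesis
    using expectation_mem[OF W] integrable_mem[OF W] by (simp add: V_def algebra_simps)
qed

text \<open>Gram-Schmidt: the residual of \<open>X\<close> over the old variables is corrected by a
  multiple of the residual of the new one. The induction generalises over \<open>X\<close> because
  its hypothesis is applied to both \<open>X\<close> and \<open>Y k\<close>.\<close>

lemma projection_exists:
  fixes Y :: "'i \<Rightarrow> 'a \<Rightarrow> real"
  assumes "finite I" "\<And>i. i \<in> I \<Longrightarrow> Y i \<in> H" "X \<in> H"
  shows "\<exists>b. \<forall>j\<in>I. expectation (\<lambda>\<omega>. (X \<omega> - (\<Sum>i\<in>I. b i * Y i \<omega>)) * Y j \<omega>) = 0"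
  using assms
proof (induction I arbitrary: X rule: finite_induct)
  case empty
  then show ?case by simp
next
  case (insert k I)
  have YI: "Y i \<in> H" if "i \<in> I" for i using insert.prems that by auto
  have Yk: "Y k \<in> H" using insert.prems by auto
  obtain b where b: "\<forall>j\<in>I. expectation (\<lambda>\<omega>. (X \<omega> - (\<Sum>i\<in>I. b i * Y i \<omega>)) * Y j \<omega>) = 0"
    using insert.IH[OF YI insert.prems(2)] by auto
  obtain c where c: "\<forall>j\<in>I. expectation (\<lambda>\<omega>. (Y k \<omega> - (\<Sum>i\<in>I. c i * Y i \<omega>)) * Y j \<omega>) = 0"
    using insert.IH[OF YI Yk] by auto
  define U where "U \<omega> = X \<omega> - (\<Sum>i\<in>I. b i * Y i \<omega>)" for \<omega>
  define S where "S \<omega> = Y k \<omega> - (\<Sum>i\<in>I. c i * Y i \<omega>)" for \<omega>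
  \<comment> \<open>The regression coefficient of \<open>U\<close> on \<open>S\<close>. If
    \<open>S\<close> has second moment 0, division by zero makes \<open>a\<close> equal to 0, and
    orthogonality to \<open>S\<close> holds because \<open>S\<close> is 0 almost surely.\<close>
  define a where "a = expectation (\<lambda>\<omega>. U \<omega> * S \<omega>) / expectation (\<lambda>\<omega>. S \<omega> * S \<omega>)"
  define N where "N \<omega> = U \<omega> - a * S \<omega>" for \<omega>
  have U: "U \<in> H" and S: "S \<in> H"
    unfolding U_def[abs_def] S_def[abs_def] using YI Yk insert.prems(2) by (auto intro: diff_sum_mem)
  then have N: "N \<in> H"
    unfolding N_def[abs_def] by (rule diff_scale_mem)
  have NI: "expectation (\<lambda>\<omega>. N \<omega> * Y j \<omega>) = 0" if "j \<in> I" for j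
    using b c that unfolding N_def
    by (simp add: expectation_mult_diff_scale[OF U S YI] flip: U_def S_def)
  have NS: "expectation (\<lambda>\<omega>. N \<omega> * S \<omega>) = 0"
  proof (cases "expectation (\<lambda>\<omega>. S \<omega> * S \<omega>) = 0")
    case True
    have [measurable]: "S \<in> borel_measurable M" "N \<in> borel_measurable M"
      using S N measurable_mem by auto
    have "AE \<omega> in M. S \<omega> * S \<omega> = 0"
      using integral_nonneg_eq_0_iff_AE[OF integrable_mult_mem[OF S S]] True by simp
    then have "expectation (\<lambda>\<omega>. N \<omega> * S \<omega>) = (\<integral>\<omega>. 0 \<partial>M)"
      by (intro integral_cong_AE) auto
    then show ?thesis by simp
  next
    case False
    then show ?thesis
      unfolding N_def by (subst expectation_mult_diff_scale[OF U S S]) (simp add: a_def)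
  qed
  \<comment> \<open>\<open>Y k\<close> is its residual \<open>S\<close> plus a combination of the
    old variables, and \<open>N\<close> is orthogonal to both.\<close>
  have "expectation (\<lambda>\<omega>. N \<omega> * Y k \<omega>) = expectation (\<lambda>\<omega>. N \<omega> * S \<omega> + N \<omega> * (\<Sum>i\<in>I. c i * Y i \<omega>))"
    by (simp add: S_def algebra_simps)
  also have "\<dots> = 0"
    using N S YI by (simp add: integrable_mult_mem sum_mem NS expectation_mult_sum NI)
  finally have Nk: "expectation (\<lambda>\<omega>. N \<omega> * Y k \<omega>) = 0" .
  have "N \<omega> = X \<omega> - (\<Sum>i\<in>insert k I. (if i = k then a else b i - a * c i) * Y i \<omega>)" for \<omega>
  proof -
    have "(\<Sum>i\<in>I. (if i = k then a else b i - a * c i) * Y i \<omega>) = (\<Sum>i\<in>I. b i * Y i \<omega> - a * (c i * Y i \<omega>))"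
      using insert.hyps by (intro sum.cong) (auto simp: algebra_simps)
    then show ?thesis
      using insert.hyps
      by (simp add: N_def U_def S_def sum_subtractf sum_distrib_left algebra_simps)
  qed
  then show ?case
    using NI Nk by (intro exI[of _ "\<lambda>i. if i = k then a else b i - a * c i"]) auto
qed

end

section \<open>Conditional independence\<close>

text \<open>Conditional Jensen inequality for the square.\<close>

lemma (in sigma_finite_subalgebra) real_cond_exp_square_integrable:
  assumes "integrable M X" "integrable M (\<lambda>\<omega>. (X \<omega>)\<^sup>2)"
  shows "integrable M (\<lambda>\<omega>. (real_cond_exp M F X \<omega>)\<^sup>2)"
  by (rule integrable_convex_cond_exp[where I = UNIV and q = power2]) (use assms convex_power2 in auto)

text \<open>Conditional independence speaks of events; it is carried over to functions one factor at
  a time, first to \<open>f\<close> of \<open>X\<close> with an event of \<open>Z\<close> fixed,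
  then to \<open>g\<close> of \<open>Z\<close>. Square integrability passes to conditional
  expectations and keeps all products integrable.\<close>

lemma (in prob_space) cond_indep_integral_eq_0:
  fixes X :: "'a \<Rightarrow> 'b::topological_space" and Z :: "'a \<Rightarrow> 'c::topological_space"
    and f :: "'b \<Rightarrow> real" and g :: "'c \<Rightarrow> real"
  assumes G: "subalgebra M G" and ci: "cond_indep M G X Z"
    and X[measurable]: "X \<in> borel_measurable M" and Z[measurable]: "Z \<in> borel_measurable M"
    and f[measurable]: "f \<in> borel_measurable borel" and g[measurable]: "g \<in> borel_measurable borel"
    and f2: "integrable M (\<lambda>\<omega>. (f (X \<omega>))\<^sup>2)" and g2: "integrable M (\<lambda>\<omega>. (g (Z \<omega>))\<^sup>2)"
  shows "expectation (\<lambda>\<omega>. (f (X \<omega>) - real_cond_exp M G (\<lambda>\<omega>. f (X \<omega>)) \<omega>) * g (Z \<omega>)) = 0"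
proof -
  interpret finite_measure_subalgebra M G by unfold_locales (rule G)
  define fX where "fX = (\<lambda>\<omega>. f (X \<omega>))"
  define fG where "fG = real_cond_exp M G fX"
  have [measurable]: "fX \<in> borel_measurable M" unfolding fX_def by measurable
  have fX2: "integrable M (\<lambda>\<omega>. (fX \<omega>)\<^sup>2)" using f2 by (simp add: fX_def)
  have fX: "integrable M fX"
    using square_integrable_imp_integrable[OF _ fX2] by simp
  have [measurable]: "fG \<in> borel_measurable M" and fG_G: "fG \<in> borel_measurable G"
    by (auto simp: fG_def)
  have fG2: "integrable M (\<lambda>\<omega>. (fG \<omega>)\<^sup>2)"
    unfolding fG_def by (rule real_cond_exp_square_integrable[OF fX fX2])
  have D2: "integrable M (\<lambda>\<omega>. (fX \<omega> - fG \<omega>)\<^sup>2)"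
  proof (rule Bochner_Integration.integrable_bound)
    show "integrable M (\<lambda>\<omega>. 2 * (fX \<omega>)\<^sup>2 + 2 * (fG \<omega>)\<^sup>2)"
      using fX2 fG2 by auto
    have "(a - b)\<^sup>2 \<le> 2 * a\<^sup>2 + 2 * b\<^sup>2" for a b :: real
      using zero_le_power2[of "a + b"] by (simp add: power2_sum power2_diff)
    then show "AE \<omega> in M. norm ((fX \<omega> - fG \<omega>)\<^sup>2) \<le> norm (2 * (fX \<omega>)\<^sup>2 + 2 * (fG \<omega>)\<^sup>2)"
      by (simp add: abs_of_nonneg)
  qed measurable
  have Z0: "expectation (\<lambda>\<omega>. indicator (Z -` B \<inter> space M) \<omega> * (fX \<omega> - fG \<omega>)) = 0"
    if B: "B \<in> sets borel" for B
  proof -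
    define b :: "'a \<Rightarrow> real" where "b = indicator (Z -` B \<inter> space M)"
    define bG where "bG = real_cond_exp M G b"
    have [measurable]: "Z -` B \<inter> space M \<in> sets M" using B by measurable
    have [measurable]: "b \<in> borel_measurable M" unfolding b_def by measurable
    have [measurable]: "bG \<in> borel_measurable M" and bG_G: "bG \<in> borel_measurable G"
      by (auto simp: bG_def)
    have b: "integrable M b"
      unfolding b_def by (intro integrable_real_indicator) (auto simp: emeasure_eq_measure)
    have "(\<lambda>\<omega>. (b \<omega>)\<^sup>2) = b"
      by (auto simp: b_def indicator_def)
    then have b2: "integrable M (\<lambda>\<omega>. (b \<omega>)\<^sup>2)"
      using b by simp
    have bG: "integrable M bG" unfolding bG_def by (rule real_cond_exp_int(1)[OF b])
    have bG2: "integrable M (\<lambda>\<omega>. (bG \<omega>)\<^sup>2)"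
      unfolding bG_def by (rule real_cond_exp_square_integrable[OF b b2])
    \<comment> \<open>For fixed \<open>B\<close>, the indicator \<open>b\<close> and its conditional
      expectation \<open>bG\<close> have equal integrals over every event of \<open>X\<close>, hence
      against \<open>f (X \<omega>)\<close>.\<close>
    have "expectation (\<lambda>\<omega>. f (X \<omega>) * (b \<omega> - bG \<omega>)) = 0"
    proof (rule integral_mult_eq_0_vimage[where g = f and X = X])
      fix C :: "'b set" assume C: "C \<in> sets borel"
      define a :: "'a \<Rightarrow> real" where "a = indicator (X -` C \<inter> space M)"
      have [measurable]: "X -` C \<inter> space M \<in> sets M" using C by measurable
      have [measurable]: "a \<in> borel_measurable M" unfolding a_def by measurable
      have ab: "indicator (X -` C \<inter> Z -` B \<inter> space M) = (\<lambda>\<omega>. a \<omega> * b \<omega>)"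
        by (auto simp: a_def b_def indicator_def)
      have iab: "integrable M (\<lambda>\<omega>. a \<omega> * b \<omega>)"
        using integrable_mult_indicator[OF _ b, of "X -` C \<inter> space M"] by (simp add: a_def)
      have iabG: "integrable M (\<lambda>\<omega>. bG \<omega> * a \<omega>)"
        using integrable_mult_indicator[OF _ bG, of "X -` C \<inter> space M"] by (simp add: a_def mult.commute)
      have "expectation (\<lambda>\<omega>. bG \<omega> * a \<omega>) = expectation (\<lambda>\<omega>. bG \<omega> * real_cond_exp M G a \<omega>)"
        by (rule real_cond_exp_intg(2)[symmetric]) (use iabG bG_G in auto)
      also have "\<dots> = expectation (real_cond_exp M G (\<lambda>\<omega>. a \<omega> * b \<omega>))"
      proof (rule integral_cong_AE)
        have "AE \<omega> in M. real_cond_exp M G (\<lambda>\<omega>. a \<omega> * b \<omega>) \<omega> = real_cond_exp M G a \<omega> * bG \<omega>"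
          unfolding ab[symmetric] unfolding bG_def a_def b_def
          using ci C B by (simp add: cond_indep_def)
        then show "AE \<omega> in M. bG \<omega> * real_cond_exp M G a \<omega> = real_cond_exp M G (\<lambda>\<omega>. a \<omega> * b \<omega>) \<omega>"
          by eventually_elim simp
      qed auto
      also have "\<dots> = expectation (\<lambda>\<omega>. a \<omega> * b \<omega>)"
        by (rule real_cond_exp_int(2)[OF iab])
      finally have "expectation (\<lambda>\<omega>. a \<omega> * b \<omega> - bG \<omega> * a \<omega>) = 0"
        using iab iabG by simp
      then show "expectation (\<lambda>\<omega>. indicator (X -` C \<inter> space M) \<omega> * (b \<omega> - bG \<omega>)) = 0"
        by (simp add: a_def algebra_simps)
    next
      show "integrable M (\<lambda>\<omega>. f (X \<omega>) * (b \<omega> - bG \<omega>))"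
        using integrable_mult_square_integrable[OF _ _ fX2 b2] integrable_mult_square_integrable[OF _ _ fX2 bG2]
        by (simp add: right_diff_distrib fX_def)
    qed (use b bG in auto)
    moreover have i: "integrable M (\<lambda>\<omega>. fX \<omega> * b \<omega>)" "integrable M (\<lambda>\<omega>. bG \<omega> * fX \<omega>)"
      "integrable M (\<lambda>\<omega>. fG \<omega> * b \<omega>)"
      by (auto intro!: integrable_mult_square_integrable fX2 b2 bG2 fG2)
    ultimately have "expectation (\<lambda>\<omega>. fX \<omega> * b \<omega>) = expectation (\<lambda>\<omega>. bG \<omega> * fX \<omega>)"
      by (simp add: algebra_simps fX_def)
    \<comment> \<open>Conditional expectation is self-adjoint: \<open>bG\<close> against
      \<open>fX\<close>, \<open>bG\<close> against \<open>fG\<close> and \<open>b\<close> against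
      \<open>fG\<close> all have the same integral.\<close>
    also have "\<dots> = expectation (\<lambda>\<omega>. bG \<omega> * fG \<omega>)"
      unfolding fG_def by (rule real_cond_exp_intg(2)[symmetric]) (use i bG_G in auto)
    also have "\<dots> = expectation (\<lambda>\<omega>. fG \<omega> * bG \<omega>)"
      by (simp add: mult.commute)
    also have "\<dots> = expectation (\<lambda>\<omega>. fG \<omega> * b \<omega>)"
      unfolding bG_def by (rule real_cond_exp_intg(2)) (use i fG_G in auto)
    finally have "expectation (\<lambda>\<omega>. fX \<omega> * b \<omega> - fG \<omega> * b \<omega>) = 0"
      using i by simp
    then show ?thesis by (simp add: b_def algebra_simps)
  qed
  \<comment> \<open>\<open>Z0\<close> covers all events of \<open>Z\<close>; the second passage from
    events to functions gives \<open>g (Z \<omega>)\<close>.\<close>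
  have "expectation (\<lambda>\<omega>. g (Z \<omega>) * (fX \<omega> - fG \<omega>)) = 0"
  proof (rule integral_mult_eq_0_vimage[where g = g and X = Z, OF Z _ Z0 g])
    show "integrable M (\<lambda>\<omega>. fX \<omega> - fG \<omega>)"
      using fX by (auto simp: fG_def)
    show "integrable M (\<lambda>\<omega>. g (Z \<omega>) * (fX \<omega> - fG \<omega>))"
      by (intro integrable_mult_square_integrable g2 D2) auto
  qed
  then show ?thesis
    by (simp add: fX_def fG_def mult.commute)
qed

section \<open>Linear functionals of independent Gaussian vectors\<close>

lemma real_gaussian0_cong:
  assumes eq: "\<And>\<omega>. \<omega> \<in> space M \<Longrightarrow> X \<omega> = Y \<omega>"
  shows "real_gaussian0 M X v \<longleftrightarrow> real_gaussian0 M Y v"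
proof -
  have "X \<in> borel_measurable M \<longleftrightarrow> Y \<in> borel_measurable M"
    using eq by (rule measurable_cong)
  moreover have "(AE \<omega> in M. X \<omega> = 0) \<longleftrightarrow> (AE \<omega> in M. Y \<omega> = 0)"
    using eq by (intro AE_cong) auto
  moreover have "distr M lborel X = distr M lborel Y"
    using eq by (intro distr_cong) auto
  ultimately show ?thesis
    by (auto simp: real_gaussian0_def distributed_def)
qed

definition linear_functionals ::
  "'a measure \<Rightarrow> ('s \<Rightarrow> 'a \<Rightarrow> 'e::real_inner) \<Rightarrow> 's set \<Rightarrow> ('a \<Rightarrow> real) set" where
  "linear_functionals M S K = {L. \<exists>c. \<forall>\<omega>\<in>space M. L \<omega> = (\<Sum>s\<in>K. c s \<bullet> S s \<omega>)}"

lemma linear_functionals_cong: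
  "L \<in> linear_functionals M S K \<Longrightarrow> (\<And>\<omega>. \<omega> \<in> space M \<Longrightarrow> L' \<omega> = L \<omega>) \<Longrightarrow> L' \<in> linear_functionals M S K"
  by (simp add: linear_functionals_def)

lemma linear_functionals_mono:
  assumes "K \<subseteq> K'" "finite K'"
  shows "linear_functionals M S K \<subseteq> linear_functionals M S K'"
proof
  fix L assume "L \<in> linear_functionals M S K"
  then obtain c where c: "\<forall>\<omega>\<in>space M. L \<omega> = (\<Sum>s\<in>K. c s \<bullet> S s \<omega>)"
    by (auto simp: linear_functionals_def)
  have "(\<Sum>s\<in>K. c s \<bullet> S s \<omega>) = (\<Sum>s\<in>K'. (if s \<in> K then c s else 0) \<bullet> S s \<omega>)" for \<omega>
    using assms by (intro sum.mono_neutral_cong_left) auto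
  with c show "L \<in> linear_functionals M S K'"
    unfolding linear_functionals_def by (intro CollectI exI[of _ "\<lambda>s. if s \<in> K then c s else 0"]) simp
qed

lemma inner_mem_linear_functionals:
  assumes "finite K" "s \<in> K"
  shows "(\<lambda>\<omega>. c \<bullet> S s \<omega>) \<in> linear_functionals M S K"
proof -
  have "c \<bullet> S s \<omega> = (\<Sum>t\<in>K. (if t = s then c else 0) \<bullet> S t \<omega>)" for \<omega>
    using assms sum.remove[of K s "\<lambda>t. (if t = s then c else 0) \<bullet> S t \<omega>"]
    by (simp add: sum.neutral)
  then show ?thesis
    unfolding linear_functionals_def by (intro CollectI exI[of _ "\<lambda>t. if t = s then c else 0"]) simp
qed

lemma (in prob_space) gaussian_space_linear_functionals:
  fixes S :: "'s \<Rightarrow> 'a \<Rightarrow> 'e::euclidean_space"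
  assumes I: "finite I" and ind: "indep_vars (\<lambda>_. borel) S I"
    and g: "\<And>s c. s \<in> I \<Longrightarrow> \<exists>v. real_gaussian0 M (\<lambda>\<omega>. c \<bullet> S s \<omega>) v"
  shows "gaussian_space M (linear_functionals M S I)"
proof unfold_locales
  fix X Y assume X: "X \<in> linear_functionals M S I" and Y: "Y \<in> linear_functionals M S I"
  from X obtain c where c: "\<forall>\<omega>\<in>space M. X \<omega> = (\<Sum>s\<in>I. c s \<bullet> S s \<omega>)"
    by (auto simp: linear_functionals_def)
  from Y obtain d where d: "\<forall>\<omega>\<in>space M. Y \<omega> = (\<Sum>s\<in>I. d s \<bullet> S s \<omega>)"
    by (auto simp: linear_functionals_def)
  show "(\<lambda>\<omega>. X \<omega> + Y \<omega>) \<in> linear_functionals M S I"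
    using c d unfolding linear_functionals_def
    by (intro CollectI exI[of _ "\<lambda>s. c s + d s"]) (simp add: inner_add_left sum.distrib)
next
  fix X and a :: real assume "X \<in> linear_functionals M S I"
  then obtain c where c: "\<forall>\<omega>\<in>space M. X \<omega> = (\<Sum>s\<in>I. c s \<bullet> S s \<omega>)"
    by (auto simp: linear_functionals_def)
  then show "(\<lambda>\<omega>. a * X \<omega>) \<in> linear_functionals M S I"
    unfolding linear_functionals_def
    by (intro CollectI exI[of _ "\<lambda>s. a *\<^sub>R c s"]) (simp add: sum_distrib_left)
next
  show "(\<lambda>_. 0) \<in> linear_functionals M S I"
    unfolding linear_functionals_def by (intro CollectI exI[of _ "\<lambda>_. 0"]) simp
next
  fix X assume "X \<in> linear_functionals M S I"
  then obtain c where c: "\<forall>\<omega>\<in>space M. X \<omega> = (\<Sum>s\<in>I. c s \<bullet> S s \<omega>)"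
    by (auto simp: linear_functionals_def)
  have "\<forall>s\<in>I. \<exists>v. real_gaussian0 M (\<lambda>\<omega>. c s \<bullet> S s \<omega>) v"
    using g by auto
  then obtain v where v: "\<And>s. s \<in> I \<Longrightarrow> real_gaussian0 M (\<lambda>\<omega>. c s \<bullet> S s \<omega>) (v s)"
    by metis
  have "indep_vars (\<lambda>_. borel) (\<lambda>s \<omega>. c s \<bullet> S s \<omega>) I"
    by (rule indep_vars_compose2[OF ind]) auto
  then obtain w where "real_gaussian0 M (\<lambda>\<omega>. \<Sum>s\<in>I. c s \<bullet> S s \<omega>) w"
    using real_gaussian0_sum[OF I, of "\<lambda>s \<omega>. c s \<bullet> S s \<omega>" v] v by blast
  then show "\<exists>v. real_gaussian0 M X v"
    using real_gaussian0_cong[of M X "\<lambda>\<omega>. \<Sum>s\<in>I. c s \<bullet> S s \<omega>"] c by auto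
qed

lemma (in prob_space) linear_functionals_uncorrelated:
  fixes S :: "'s \<Rightarrow> 'a \<Rightarrow> 'e::euclidean_space"
  assumes I: "finite I" and ind: "indep_vars (\<lambda>_. borel) S I"
    and g: "\<And>s c. s \<in> I \<Longrightarrow> \<exists>v. real_gaussian0 M (\<lambda>\<omega>. c \<bullet> S s \<omega>) v"
    and s: "s \<in> I" and L: "L \<in> linear_functionals M S (I - {s})"
  shows "expectation (\<lambda>\<omega>. (c \<bullet> S s \<omega>) * L \<omega>) = 0"
proof -
  interpret gaussian_space M "linear_functionals M S I"
    using I ind g by (rule gaussian_space_linear_functionals)
  from L obtain d where d: "\<forall>\<omega>\<in>space M. L \<omega> = (\<Sum>t\<in>I - {s}. d t \<bullet> S t \<omega>)"
    by (auto simp: linear_functionals_def)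
  define X where "X t \<omega> = (if t = s then c else d t) \<bullet> S t \<omega>" for t \<omega>
  have "indep_vars (\<lambda>_. borel) X I"
    unfolding X_def[abs_def] by (rule indep_vars_compose2[OF ind]) auto
  then have "indep_var borel (X s) borel (\<lambda>\<omega>. \<Sum>t\<in>I - {s}. X t \<omega>)"
    using I s by (intro indep_vars_sum) (auto simp: insert_absorb)
  moreover have "(\<lambda>\<omega>. \<Sum>t\<in>I - {s}. X t \<omega>) \<in> linear_functionals M S (I - {s})"
    unfolding linear_functionals_def X_def
    by (intro CollectI exI[of _ "\<lambda>t. if t = s then c else d t"]) simp
  then have "(\<lambda>\<omega>. \<Sum>t\<in>I - {s}. X t \<omega>) \<in> linear_functionals M S I"
    using linear_functionals_mono[of "I - {s}" I] I by blast
  moreover have Xs: "X s \<in> linear_functionals M S I"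
    unfolding X_def[abs_def] by (rule inner_mem_linear_functionals[OF I s])
  ultimately have "expectation (\<lambda>\<omega>. X s \<omega> * (\<Sum>t\<in>I - {s}. X t \<omega>)) = 0"
    by (subst indep_var_lebesgue_integral) (auto simp: integrable_mem expectation_mem)
  also have "expectation (\<lambda>\<omega>. X s \<omega> * (\<Sum>t\<in>I - {s}. X t \<omega>)) = expectation (\<lambda>\<omega>. (c \<bullet> S s \<omega>) * L \<omega>)"
    using d by (intro Bochner_Integration.integral_cong) (auto simp: X_def intro!: sum.cong)
  finally show ?thesis .
qed

lemma borel_measurable_vecI:
  fixes f :: "'a \<Rightarrow> real ^ 'n"
  assumes "\<And>i. (\<lambda>\<omega>. f \<omega> $ i) \<in> borel_measurable M"
  shows "f \<in> borel_measurable M"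
  unfolding borel_measurable_euclidean_space[of f]
  using assms by (auto simp: Basis_vec_def inner_axis)

lemma borel_measurable_vec_nth':
  fixes f :: "'a \<Rightarrow> real ^ 'n"
  assumes "f \<in> borel_measurable M"
  shows "(\<lambda>\<omega>. f \<omega> $ i) \<in> borel_measurable M"
  using assms by (simp add: cart_eq_inner_axis)

theorem theorem3:
  fixes M :: "'a measure" and T :: nat
    and A Q :: "nat \<Rightarrow> real ^ 'n ^ 'n" and C :: "nat \<Rightarrow> real ^ 'n ^ 'm"
    and R :: "nat \<Rightarrow> real ^ 'm ^ 'm" and P0 :: "real ^ 'n ^ 'n"
    and x q :: "nat \<Rightarrow> 'a \<Rightarrow> real ^ 'n" and y r :: "nat \<Rightarrow> 'a \<Rightarrow> real ^ 'm"
    and J :: "nat \<Rightarrow> 'a \<Rightarrow> real ^ 'p"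
  assumes "prob_space M"
    and dyn: "\<And>k \<omega>. k \<in> {1..T} \<Longrightarrow> \<omega> \<in> space M \<Longrightarrow> x k \<omega> = A k *v x (k - 1) \<omega> + q k \<omega>"
    and obs: "\<And>k \<omega>. k \<le> T \<Longrightarrow> \<omega> \<in> space M \<Longrightarrow> y k \<omega> = C k *v x k \<omega> + r k \<omega>"
    and gq: "\<And>k. k \<in> {1..T} \<Longrightarrow> gaussian_vec0 M (q k) (Q k)"
    and gr: "\<And>k. k \<le> T \<Longrightarrow> gaussian_vec0 M (r k) (R k)"
    and gx0: "gaussian_vec0 M (x 0) P0"
    and ind: "prob_space.indep_vars M (\<lambda>_. borel)
        (\<lambda>i \<omega>. case i of X0 \<Rightarrow> (x 0 \<omega>, 0 :: real ^ 'm)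
                      | Qn k \<Rightarrow> (q k \<omega>, 0)
                      | Rn k \<Rightarrow> (0, r k \<omega>))
        ({X0} \<union> Qn ` {1..T} \<union> Rn ` {0..T})"
    and Jmeas: "\<And>k. k \<le> T \<Longrightarrow> J k \<in> borel_measurable M"
    and J2: "\<And>k. k \<le> T \<Longrightarrow> integrable M (\<lambda>\<omega>. (norm (J k \<omega>))\<^sup>2)"
    and ci: "\<And>k n. n \<ge> 1 \<Longrightarrow> k + n \<le> T \<Longrightarrow>
               cond_indep M (gen_sigma M y {..k}) (J k) (y (k + n))"
  shows "\<forall>k n. n \<ge> 1 \<and> k + n \<le> T \<longrightarrow>
           (\<forall>i j. prob_space.expectation M
                     (\<lambda>\<omega>. J k \<omega> $ i * innovation M C x y (k + n) \<omega> $ j) = 0)"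
proof (intro allI impI)
  interpret prob_space M by fact
  define S :: "src_idx \<Rightarrow> 'a \<Rightarrow> (real ^ 'n) \<times> (real ^ 'm)" where
    "S s \<omega> = (case s of X0 \<Rightarrow> (x 0 \<omega>, 0) | Qn k \<Rightarrow> (q k \<omega>, 0) | Rn k \<Rightarrow> (0, r k \<omega>))" for s \<omega>
  define I where "I = {X0} \<union> Qn ` {1..T} \<union> Rn ` {0..T}"
  have I: "finite I" by (simp add: I_def)
  have indS: "indep_vars (\<lambda>_. borel) S I"
    using ind by (simp add: S_def[abs_def] I_def)
  have gS: "\<exists>v. real_gaussian0 M (\<lambda>\<omega>. c \<bullet> S s \<omega>) v" if "s \<in> I" for s c
  proof (cases s)
    case X0
    then have "real_gaussian0 M (\<lambda>\<omega>. fst c \<bullet> x 0 \<omega>) (fst c \<bullet> (P0 *v fst c))"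
      using gx0 by (auto simp: I_def gaussian_vec0_def)
    then show ?thesis
      using X0 by (intro exI) (simp add: S_def inner_prod_def)
  next
    case (Qn l)
    then have "real_gaussian0 M (\<lambda>\<omega>. fst c \<bullet> q l \<omega>) (fst c \<bullet> (Q l *v fst c))"
      using that gq[of l] by (auto simp: I_def gaussian_vec0_def)
    then show ?thesis
      using Qn by (intro exI) (simp add: S_def inner_prod_def)
  next
    case (Rn l)
    then have "real_gaussian0 M (\<lambda>\<omega>. snd c \<bullet> r l \<omega>) (snd c \<bullet> (R l *v snd c))"
      using that gr[of l] by (auto simp: I_def gaussian_vec0_def)
    then show ?thesis
      using Rn by (intro exI) (simp add: S_def inner_prod_def)
  qed
  have gs: "gaussian_space M (linear_functionals M S K)" if "K \<subseteq> I" for K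
    by (rule gaussian_space_linear_functionals)
       (use that I indep_vars_subset[OF indS that] gS in \<open>auto intro: finite_subset\<close>)
  have mem_x0: "(\<lambda>\<omega>. x 0 \<omega> $ a) \<in> linear_functionals M S K" if "finite K" "X0 \<in> K" for a K
    using inner_mem_linear_functionals[OF that, of "(axis a 1, 0)" S M]
    by (simp add: S_def inner_Pair inner_axis')
  have mem_q: "(\<lambda>\<omega>. q l \<omega> $ a) \<in> linear_functionals M S K" if "finite K" "Qn l \<in> K" for a l K
    using inner_mem_linear_functionals[OF that, of "(axis a 1, 0)" S M]
    by (simp add: S_def inner_Pair inner_axis')
  have mem_r: "(\<lambda>\<omega>. r l \<omega> $ a) \<in> linear_functionals M S K" if "finite K" "Rn l \<in> K" for a l K
    using inner_mem_linear_functionals[OF that, of "(0, axis a 1)" S M]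
    by (simp add: S_def inner_Pair inner_axis')
  have mem_x: "(\<lambda>\<omega>. x l \<omega> $ a) \<in> linear_functionals M S K"
    if "l \<le> T" "K \<subseteq> I" "{X0} \<union> Qn ` {1..T} \<subseteq> K" for l a K
    using that(1)
  proof (induction l arbitrary: a)
    case 0
    then show ?case using that I by (intro mem_x0) (auto intro: finite_subset)
  next
    case (Suc l)
    interpret K: gaussian_space M "linear_functionals M S K" by (rule gs[OF that(2)])
    have "(\<lambda>\<omega>. q (Suc l) \<omega> $ a) \<in> linear_functionals M S K"
      using that I Suc.prems by (intro mem_q) (auto intro: finite_subset)
    then have "(\<lambda>\<omega>. (\<Sum>b\<in>UNIV. A (Suc l) $ a $ b * x l \<omega> $ b) + q (Suc l) \<omega> $ a) \<in> linear_functionals M S K"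
      using Suc by (intro K.add_mem K.sum_mem) auto
    then show ?case
      by (rule linear_functionals_cong) (use dyn[of "Suc l"] Suc.prems in \<open>auto simp: matrix_vector_mult_def\<close>)
  qed
  have mem_y: "(\<lambda>\<omega>. y l \<omega> $ a) \<in> linear_functionals M S K"
    if "l \<le> T" "K \<subseteq> I" "{X0} \<union> Qn ` {1..T} \<subseteq> K" "Rn l \<in> K" for l a K
  proof -
    interpret K: gaussian_space M "linear_functionals M S K" by (rule gs[OF that(2)])
    have "(\<lambda>\<omega>. r l \<omega> $ a) \<in> linear_functionals M S K"
      using that I by (intro mem_r) (auto intro: finite_subset)
    then have "(\<lambda>\<omega>. (\<Sum>b\<in>UNIV. C l $ a $ b * x l \<omega> $ b) + r l \<omega> $ a) \<in> linear_functionals M S K"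
      using mem_x[OF that(1-3)] by (intro K.add_mem K.sum_mem) auto
    then show ?thesis
      by (rule linear_functionals_cong) (use obs[OF that(1)] in \<open>auto simp: matrix_vector_mult_def\<close>)
  qed
  interpret gaussian_space M "linear_functionals M S I" by (rule gs) simp
  have xI: "(\<lambda>\<omega>. x l \<omega> $ a) \<in> linear_functionals M S I" if "l \<le> T" for l a
    using that by (intro mem_x) (auto simp: I_def)
  have yI: "(\<lambda>\<omega>. y l \<omega> $ a) \<in> linear_functionals M S I" if "l \<le> T" for l a
    using that by (intro mem_y) (auto simp: I_def)
  have rI: "(\<lambda>\<omega>. r l \<omega> $ a) \<in> linear_functionals M S I" if "l \<le> T" for l a
    using that I by (intro mem_r) (auto simp: I_def)
  have r_y: "expectation (\<lambda>\<omega>. r m \<omega> $ a * y l \<omega> $ b) = 0" if "m \<le> T" "l < m" for m l a b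
  proof -
    have "Rn m \<in> I" using that by (simp add: I_def)
    moreover have "(\<lambda>\<omega>. y l \<omega> $ b) \<in> linear_functionals M S (I - {Rn m})"
      using that by (intro mem_y) (auto simp: I_def)
    ultimately have "expectation (\<lambda>\<omega>. ((0, axis a 1) \<bullet> S (Rn m) \<omega>) * y l \<omega> $ b) = 0"
      by (intro linear_functionals_uncorrelated[where L = "\<lambda>\<omega>. y l \<omega> $ b", OF I indS gS])
    then show ?thesis by (simp add: S_def inner_Pair inner_axis')
  qed
  have ym: "y l \<in> borel_measurable M" if "l \<le> T" for l
    using that by (intro borel_measurable_vecI measurable_mem yI)

  fix k n i j assume "1 \<le> n \<and> k + n \<le> T"
  then have n: "1 \<le> n" and kn: "k + n \<le> T" by auto
  define m where "m = k + n"
  have m: "k < m" "m \<le> T" using n kn by (auto simp: m_def)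
  define G where "G = gen_sigma M y {..k}"
  define F where "F = gen_sigma M y {..<m}"
  have G: "subalgebra M G" and F: "subalgebra M F"
    using ym m by (auto simp: G_def F_def intro!: subalgebra_gen_sigma)
  have "sets G \<subseteq> sets F"
    unfolding G_def using m
    by (intro sets_gen_sigma_least) (auto simp: F_def intro!: measurable_gen_sigma)
  then have GF: "subalgebra F G"
    using G F by (simp add: subalgebra_def)
  interpret G: finite_measure_subalgebra M G by unfold_locales (rule G)
  interpret F: finite_measure_subalgebra M F by unfold_locales (rule F)
  define P where "P = {..<m} \<times> (UNIV :: 'm set)"
  define Y where "Y p \<omega> = y (fst p) \<omega> $ snd p" for p :: "nat \<times> 'm" and \<omega>
  have P: "finite P" by (simp add: P_def)
  have Y: "Y p \<in> linear_functionals M S I" if "fst p \<le> T" for p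
    unfolding Y_def[abs_def] using that by (rule yI)
  have YP: "Y p \<in> linear_functionals M S I" if "p \<in> P" for p
    using that m by (intro Y) (auto simp: P_def)
  have YF: "Y p \<in> borel_measurable F" if "p \<in> P" for p
    unfolding Y_def[abs_def] F_def using that
    by (intro borel_measurable_vec_nth' measurable_gen_sigma) (auto simp: P_def)
  have FP: "sets F \<subseteq> sets (gen_sigma M Y P)"
    unfolding F_def
  proof (rule sets_gen_sigma_least)
    fix l assume l: "l \<in> {..<m}"
    show "y l \<in> borel_measurable (gen_sigma M Y P)"
    proof (rule borel_measurable_vecI)
      fix a
      show "(\<lambda>\<omega>. y l \<omega> $ a) \<in> borel_measurable (gen_sigma M Y P)"
        using measurable_gen_sigma[of "(l, a)" P Y M] l by (simp add: P_def Y_def[abs_def])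
    qed
  qed simp
  have "\<exists>b. \<forall>p\<in>P. expectation (\<lambda>\<omega>. (x m \<omega> $ a - (\<Sum>s\<in>P. b s * Y s \<omega>)) * Y p \<omega>) = 0" for a
    by (rule projection_exists[OF P YP xI]) (use m in auto)
  then obtain b where b: "\<And>a p. p \<in> P \<Longrightarrow>
      expectation (\<lambda>\<omega>. (x m \<omega> $ a - (\<Sum>s\<in>P. b a s * Y s \<omega>)) * Y p \<omega>) = 0"
    using choice[of "\<lambda>a b. \<forall>p\<in>P. expectation (\<lambda>\<omega>. (x m \<omega> $ a - (\<Sum>s\<in>P. b s * Y s \<omega>)) * Y p \<omega>) = 0"]
    by blast
  define E where "E a \<omega> = x m \<omega> $ a - (\<Sum>s\<in>P. b a s * Y s \<omega>)" for a \<omega>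
  have E: "E a \<in> linear_functionals M S I" for a
    unfolding E_def[abs_def] by (intro diff_sum_mem xI m YP)
  have orthF: "expectation (\<lambda>\<omega>. indicator B \<omega> * W \<omega>) = 0"
    if "W \<in> linear_functionals M S I" "\<And>p. p \<in> P \<Longrightarrow> expectation (\<lambda>\<omega>. W \<omega> * Y p \<omega>) = 0" "B \<in> sets F" for W B
    using that(3) FP by (intro uncorrelated_imp_integral_eq_0[OF P YP that(1,2)]) auto
  have ce: "AE \<omega> in M. real_cond_exp M F (\<lambda>\<eta>. x m \<eta> $ a) \<omega> = (\<Sum>s\<in>P. b a s * Y s \<omega>)" for a
  proof (rule F.real_cond_exp_charact)
    fix B assume B: "B \<in> sets F"
    have BM: "B \<in> sets M" using B F by (auto simp: subalgebra_def)
    have i: "integrable M (\<lambda>\<omega>. indicator B \<omega> * x m \<omega> $ a)"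
      "integrable M (\<lambda>\<omega>. indicator B \<omega> * (\<Sum>s\<in>P. b a s * Y s \<omega>))"
      using integrable_mult_indicator[OF BM integrable_mem[OF xI[OF m(2)]]]
        integrable_mult_indicator[OF BM integrable_mem[OF sum_mem[OF YP]]] by auto
    have "0 = expectation (\<lambda>\<omega>. indicator B \<omega> * E a \<omega>)"
      by (rule orthF[symmetric, OF E _ B]) (use b in \<open>simp add: E_def\<close>)
    also have "\<dots> = expectation (\<lambda>\<omega>. indicator B \<omega> * x m \<omega> $ a - indicator B \<omega> * (\<Sum>s\<in>P. b a s * Y s \<omega>))"
      by (simp add: E_def right_diff_distrib)
    finally show "(\<integral>\<omega>\<in>B. x m \<omega> $ a \<partial>M) = (\<integral>\<omega>\<in>B. (\<Sum>s\<in>P. b a s * Y s \<omega>) \<partial>M)"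
      using i by (simp add: set_lebesgue_integral_def)
  qed (use YF in \<open>auto intro!: integrable_mem xI m sum_mem YP\<close>)

  define d where "d p = (\<Sum>a\<in>UNIV. C m $ j $ a * b a p)" for p
  define N where "N \<omega> = r m \<omega> $ j + (\<Sum>a\<in>UNIV. C m $ j $ a * E a \<omega>)" for \<omega>
  have N: "N \<in> linear_functionals M S I"
    unfolding N_def[abs_def] by (intro add_mem sum_mem rI E m)
  have CE: "(\<Sum>a\<in>UNIV. C m $ j $ a * (\<Sum>s\<in>P. b a s * Y s \<omega>)) = (\<Sum>s\<in>P. d s * Y s \<omega>)" for \<omega>
    unfolding d_def sum_distrib_left sum_distrib_right
    by (subst sum.swap) (simp add: mult.assoc)
  have y_m: "y m \<omega> $ j = (\<Sum>a\<in>UNIV. C m $ j $ a * x m \<omega> $ a) + r m \<omega> $ j" if "\<omega> \<in> space M" for \<omega>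
    using obs[OF m(2) that] by (simp add: matrix_vector_mult_def)
  have N_eq: "N \<omega> = Y (m, j) \<omega> - (\<Sum>s\<in>P. d s * Y s \<omega>)" if "\<omega> \<in> space M" for \<omega>
    using y_m[OF that] CE[of \<omega>]
    by (simp add: N_def E_def Y_def right_diff_distrib sum_subtractf)
  have inn: "innovation M C x y m \<omega> $ j = y m \<omega> $ j - (\<Sum>a\<in>UNIV. C m $ j $ a * real_cond_exp M F (\<lambda>\<eta>. x m \<eta> $ a) \<omega>)" for \<omega>
    using m by (simp add: innovation_def vcond_exp_def matrix_vector_mult_def F_def)
  have inn_N: "AE \<omega> in M. innovation M C x y m \<omega> $ j = N \<omega>"
  proof -
    have "AE \<omega> in M. \<forall>a\<in>UNIV. real_cond_exp M F (\<lambda>\<eta>. x m \<eta> $ a) \<omega> = (\<Sum>s\<in>P. b a s * Y s \<omega>)"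
      using ce by (intro AE_finite_allI) auto
    with AE_space show ?thesis
      by eventually_elim (simp add: inn N_eq CE, simp add: Y_def)
  qed
  have NY: "expectation (\<lambda>\<omega>. N \<omega> * Y p \<omega>) = 0" if "p \<in> P" for p
  proof -
    have "fst p < m" using that by (auto simp: P_def)
    then have "expectation (\<lambda>\<omega>. Y p \<omega> * r m \<omega> $ j) = 0"
      using r_y[OF m(2), of "fst p" j "snd p"] by (simp add: Y_def mult.commute)
    moreover have "expectation (\<lambda>\<omega>. Y p \<omega> * (\<Sum>a\<in>UNIV. C m $ j $ a * E a \<omega>)) = 0"
      using b[OF that] by (subst expectation_mult_sum[OF YP[OF that] E]) (simp add: E_def mult.commute)
    moreover have "integrable M (\<lambda>\<omega>. Y p \<omega> * r m \<omega> $ j)"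
      "integrable M (\<lambda>\<omega>. Y p \<omega> * (\<Sum>a\<in>UNIV. C m $ j $ a * E a \<omega>))"
      using YP[OF that] by (auto intro!: integrable_mult_mem rI m sum_mem E)
    ultimately have "expectation (\<lambda>\<omega>. Y p \<omega> * r m \<omega> $ j + Y p \<omega> * (\<Sum>a\<in>UNIV. C m $ j $ a * E a \<omega>)) = 0"
      by simp
    then show ?thesis by (simp add: N_def algebra_simps)
  qed

  define f where "f \<omega> = J k \<omega> $ i" for \<omega>
  define fG where "fG = real_cond_exp M G f"
  have Jk[measurable]: "J k \<in> borel_measurable M" using Jmeas m by simp
  have fm[measurable]: "f \<in> borel_measurable M"
    unfolding f_def[abs_def] by (rule borel_measurable_vec_nth'[OF Jk])
  have f2: "integrable M (\<lambda>\<omega>. (f \<omega>)\<^sup>2)"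
  proof (rule Bochner_Integration.integrable_bound)
    show "integrable M (\<lambda>\<omega>. (norm (J k \<omega>))\<^sup>2)" using J2 m by simp
    show "AE \<omega> in M. norm ((f \<omega>)\<^sup>2) \<le> norm ((norm (J k \<omega>))\<^sup>2)"
      by (simp add: f_def norm_nth_le component_le_norm_cart abs_le_square_iff[symmetric])
  qed measurable
  have f: "integrable M f"
    by (rule square_integrable_imp_integrable[OF fm f2])
  have fGm[measurable]: "fG \<in> borel_measurable M" and fG_G: "fG \<in> borel_measurable G"
    by (auto simp: fG_def)
  have fG_F: "fG \<in> borel_measurable F"
    using measurable_from_subalg[OF GF fG_G] .
  have fG2: "integrable M (\<lambda>\<omega>. (fG \<omega>)\<^sup>2)"
    unfolding fG_def by (rule G.real_cond_exp_square_integrable[OF f f2])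
  have int: "integrable M (\<lambda>\<omega>. f \<omega> * W \<omega>)" "integrable M (\<lambda>\<omega>. fG \<omega> * W \<omega>)"
    if "W \<in> linear_functionals M S I" for W
    using integrable_mult_square_integrable[OF fm measurable_mem f2 square_integrable_mem]
      integrable_mult_square_integrable[OF fGm measurable_mem fG2 square_integrable_mem] that by auto
  have fG_N: "expectation (\<lambda>\<omega>. fG \<omega> * N \<omega>) = 0"
    by (rule integral_mult_eq_0_subalgebra[OF F integrable_mem[OF N] orthF[OF N NY] fG_F int(2)[OF N]])
  define D where "D \<omega> = f \<omega> - fG \<omega>" for \<omega>
  have iD: "integrable M (\<lambda>\<omega>. D \<omega> * W \<omega>)" if "W \<in> linear_functionals M S I" for W
    using int[OF that] by (simp add: D_def left_diff_distrib)
  have DY: "expectation (\<lambda>\<omega>. D \<omega> * Y p \<omega>) = 0" if p: "fst p \<le> m" for p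
  proof (cases "fst p \<le> k")
    case True
    have YH: "Y p \<in> linear_functionals M S I" using p m by (intro Y) auto
    have "Y p \<in> borel_measurable G"
      unfolding Y_def[abs_def] G_def using True
      by (intro borel_measurable_vec_nth' measurable_gen_sigma) auto
    then have "expectation (\<lambda>\<omega>. Y p \<omega> * fG \<omega>) = expectation (\<lambda>\<omega>. Y p \<omega> * f \<omega>)"
      unfolding fG_def using int(1)[OF YH] by (intro G.real_cond_exp_intg(2)) (auto simp: mult.commute)
    then show ?thesis
      using int[OF YH] by (simp add: D_def left_diff_distrib mult.commute[of "Y p _"])
  next
    case False
    have "cond_indep M G (J k) (y (k + (fst p - k)))"
      unfolding G_def using False p m by (intro ci) auto
    then have "cond_indep M G (J k) (y (fst p))"
      using False by simp
    then have "expectation (\<lambda>\<omega>. (J k \<omega> $ i - real_cond_exp M G (\<lambda>\<omega>. J k \<omega> $ i) \<omega>) * y (fst p) \<omega> $ snd p) = 0"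
      by (rule cond_indep_integral_eq_0[OF G])
         (use p m f2 square_integrable_mem[OF Y[of p]] in
           \<open>auto simp: f_def Y_def intro!: ym borel_measurable_vec_nth'\<close>)
    then show ?thesis by (simp add: D_def fG_def f_def[abs_def] Y_def)
  qed
  have "expectation (\<lambda>\<omega>. D \<omega> * N \<omega>) =
      expectation (\<lambda>\<omega>. D \<omega> * Y (m, j) \<omega> - (\<Sum>s\<in>P. d s * (D \<omega> * Y s \<omega>)))"
    by (intro Bochner_Integration.integral_cong)
       (auto simp: N_eq right_diff_distrib sum_distrib_left mult_ac)
  also have "\<dots> = expectation (\<lambda>\<omega>. D \<omega> * Y (m, j) \<omega>) - (\<Sum>s\<in>P. d s * expectation (\<lambda>\<omega>. D \<omega> * Y s \<omega>))"
    using iD[OF Y[of "(m, j)"]] iD[OF YP] m by simp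
  also have "\<dots> = 0"
    using DY by (simp add: P_def sum.neutral)
  finally have D_N: "expectation (\<lambda>\<omega>. D \<omega> * N \<omega>) = 0" .
  have Nm[measurable]: "N \<in> borel_measurable M" using N by (rule measurable_mem)
  have "(\<lambda>\<omega>. innovation M C x y m \<omega> $ j) \<in> borel_measurable M"
    unfolding inn using measurable_mem[OF yI[OF m(2)]] by measurable
  then have "expectation (\<lambda>\<omega>. f \<omega> * innovation M C x y m \<omega> $ j) = expectation (\<lambda>\<omega>. f \<omega> * N \<omega>)"
    using inn_N by (intro integral_cong_AE) auto
  also have "\<dots> = expectation (\<lambda>\<omega>. D \<omega> * N \<omega> + fG \<omega> * N \<omega>)"
    by (simp add: D_def algebra_simps)
  also have "\<dots> = 0"
    using iD[OF N] int(2)[OF N] D_N fG_N by simp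
  finally show "expectation (\<lambda>\<omega>. J k \<omega> $ i * innovation M C x y (k + n) \<omega> $ j) = 0"
    by (simp add: f_def m_def)
qed

end
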